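(* (1) Let $p$ be a prime and let $m>n\ge 1$ be integers, with $m\ge 3$ if $p=2$. Let $$G_p(m,n)=\langle \sigma,\tau \mid \sigma^{p^m}=\tau^{p^n}=1,\ \tau\sigma\tau^{-1}=\sigma^{1+p^{m-1}}\rangle,$$ a non-abelian group of order $p^{m+n}$. Then $G_p(m,n)$ and the abelian group $C_{p^m}\times C_{p^n}$ have the same zeta function, and this zeta function satisfies the symmetry: for $G=G_p(m,n)$, $\zeta_G(s)=|G|^{-s}\zeta_G(-s)$. (2) The $p$-groups of order less than or equal to $p^2$ if $p$ is an odd prime, and the $2$-groups of order less than or equal to $2^3$, are determined up to isomorphism by their zeta functions (that is, if $G$ is such a group and $G'$ is a finite group with $\zeta_{G'}(s)=\zeta_G(s)$, then $G'\cong G$).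
   Context: All groups are finite; $C_k$ denotes the cyclic group of order $k$. For a finite group $G$ and $k\ge 1$, let $a_k(G)$ be the number of subgroups of $G$ of order $k$. The zeta function of $G$ is $\zeta_G(s)=\sum_{k\ge1} a_k(G)\,k^{-s}=\sum_{H\le G}|H|^{-s}$, $s\in\mathbb C$. Equality of zeta functions means equality as functions of $s$. *)

theory Defs
  imports
    "HOL-Analysis.Analysis"
    "HOL-Computational_Algebra.Primes"
    "HOL-Algebra.Elementary_Groups"
begin

hide_const (open) Polynomial.order

section \<open>The zeta function of a finite group\<close>

definition num_subgroups :: "nat \<Rightarrow> ('a, 'c) monoid_scheme \<Rightarrow> nat" where
  "num_subgroups k G = card {H. subgroup H G \<and> card H = k}"

text \<open>For finite groups only finitely many terms are non-zero.\<close>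

definition group_zeta :: "('a, 'c) monoid_scheme \<Rightarrow> complex \<Rightarrow> complex" where
  "group_zeta G s = (\<Sum>\<^sub>\<infinity>k\<in>{1..}. of_nat (num_subgroups k G) * of_nat k powr (- s))"

lemma group_zeta_eq_sum_subgroups:
  assumes "group G" and fin: "finite (carrier G)"
  shows "group_zeta G s = (\<Sum>H | subgroup H G. of_nat (card H) powr (- s))"
proof -
  interpret group G by fact
  let ?S = "{H. subgroup H G}"
  have finS: "finite ?S"
    by (rule finite_subset[of _ "Pow (carrier G)"]) (use fin in \<open>auto dest: subgroup.subset\<close>)
  have pos: "card H \<ge> 1" if "subgroup H G" for H
    using subgroup.finite_imp_card_positive[OF that fin] by simp
  have "group_zeta G s = (\<Sum>\<^sub>\<infinity>k\<in>card ` ?S. of_nat (num_subgroups k G) * of_nat k powr (- s))"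
    unfolding group_zeta_def
  proof (rule infsum_cong_neutral)
    fix k assume "k \<in> {1..} - card ` ?S"
    then have eq: "{H. subgroup H G \<and> card H = k} = {}" by auto
    show "of_nat (num_subgroups k G) * of_nat k powr (- s) = 0"
      unfolding num_subgroups_def eq by simp
  qed (use pos in auto)
  also have "\<dots> = (\<Sum>k\<in>card ` ?S. \<Sum>H\<in>{H \<in> ?S. card H = k}. of_nat (card H) powr (- s))"
    using finS by (simp add: num_subgroups_def)
  also have "\<dots> = (\<Sum>H\<in>?S. of_nat (card H) powr (- s))"
    by (rule sum.image_gen[OF finS, symmetric])
  finally show ?thesis .
qed

section \<open>Groups given by generators and relations\<close>

text \<open>A letter \<open>(x, True)\<close> stands for the generator \<open>x\<close>, and \<open>(x, False)\<close> for its inverse.\<close>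

type_synonym 'a word = "('a \<times> bool) list"

text \<open>The congruence on words generated by the relations \<open>R\<close>, a pair \<open>(u, v)\<close> being the relation
  \<open>u = v\<close>, and by the cancellation of adjacent mutually inverse letters.\<close>

inductive_set word_cong :: "('a word \<times> 'a word) set \<Rightarrow> ('a word \<times> 'a word) set"
  for R :: "('a word \<times> 'a word) set" where
  rel: "(u, v) \<in> R \<Longrightarrow> (u, v) \<in> word_cong R"
| cancel: "([(x, b), (x, \<not> b)], []) \<in> word_cong R"
| refl: "(u, u) \<in> word_cong R"
| sym: "(u, v) \<in> word_cong R \<Longrightarrow> (v, u) \<in> word_cong R"
| trans: "(u, v) \<in> word_cong R \<Longrightarrow> (v, w) \<in> word_cong R \<Longrightarrow> (u, w) \<in> word_cong R"
| append: "(u, v) \<in> word_cong R \<Longrightarrow> (u', v') \<in> word_cong R \<Longrightarrow> (u @ u', v @ v') \<in> word_cong R"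

text \<open>The generators are all elements of the type \<open>'a\<close>.\<close>

definition presented_group :: "('a word \<times> 'a word) set \<Rightarrow> 'a word set monoid" where
  "presented_group R =
    \<lparr>carrier = UNIV // word_cong R,
     monoid.mult = (\<lambda>A B. \<Union>u\<in>A. \<Union>v\<in>B. word_cong R `` {u @ v}),
     one = word_cong R `` {[]}\<rparr>"

lemma equiv_word_cong: "equiv UNIV (word_cong R)"
proof (rule equivI)
  show "refl (word_cong R)" by (simp add: refl_on_def word_cong.refl)
  show "sym (word_cong R)" by (rule symI) (rule word_cong.sym)
  show "trans (word_cong R)" by (rule transI) (rule word_cong.trans)
qed simp

lemma presented_group_mult:
  "word_cong R `` {u} \<otimes>\<^bsub>presented_group R\<^esub> word_cong R `` {v} = word_cong R `` {u @ v}"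
proof -
  have "congruent2 (word_cong R) (word_cong R) (\<lambda>u v. word_cong R `` {u @ v})"
    unfolding congruent2_def
    by (intro ballI, clarify, rule equiv_class_eq[OF equiv_word_cong], rule word_cong.append)
  from UN_equiv_class2[OF equiv_word_cong equiv_word_cong this]
  show ?thesis by (simp add: presented_group_def)
qed

lemma group_presented_group: "group (presented_group R)"
proof (rule groupI)
  let ?G = "presented_group R"
  have carr: "A \<in> carrier ?G \<longleftrightarrow> (\<exists>u. A = word_cong R `` {u})" for A
    by (auto simp: presented_group_def quotient_def)
  have one: "\<one>\<^bsub>?G\<^esub> = word_cong R `` {[]}"
    by (simp add: presented_group_def)
  show "\<one>\<^bsub>?G\<^esub> \<in> carrier ?G" by (auto simp: carr one)
  show "A \<otimes>\<^bsub>?G\<^esub> B \<in> carrier ?G" if "A \<in> carrier ?G" "B \<in> carrier ?G" for A B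
    using that by (auto simp: carr presented_group_mult)
  show "A \<otimes>\<^bsub>?G\<^esub> B \<otimes>\<^bsub>?G\<^esub> C = A \<otimes>\<^bsub>?G\<^esub> (B \<otimes>\<^bsub>?G\<^esub> C)"
    if "A \<in> carrier ?G" "B \<in> carrier ?G" "C \<in> carrier ?G" for A B C
    using that by (auto simp: carr presented_group_mult)
  show "\<one>\<^bsub>?G\<^esub> \<otimes>\<^bsub>?G\<^esub> A = A" if "A \<in> carrier ?G" for A
    using that by (auto simp: carr one presented_group_mult)
  show "\<exists>B\<in>carrier ?G. B \<otimes>\<^bsub>?G\<^esub> A = \<one>\<^bsub>?G\<^esub>" if "A \<in> carrier ?G" for A
  proof -
    obtain u where u: "A = word_cong R `` {u}" using iffD1[OF carr \<open>A \<in> carrier ?G\<close>] ..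
    have "\<exists>v. (v @ u, []) \<in> word_cong R"
    proof (induction u)
      case Nil
      show ?case by (rule exI[of _ "[]"]) (simp add: word_cong.refl)
    next
      case (Cons a u)
      obtain x b where a: "a = (x, b)" by (cases a)
      obtain v where v: "(v @ u, []) \<in> word_cong R" using Cons by blast
      have "([(x, \<not> b), (x, b)], []) \<in> word_cong R"
        using word_cong.cancel[of x "\<not> b" R] by simp
      then have "(v @ ([(x, \<not> b), (x, b)] @ u), v @ ([] @ u)) \<in> word_cong R"
        by (intro word_cong.append word_cong.refl)
      with v have "((v @ [(x, \<not> b)]) @ a # u, []) \<in> word_cong R"
        using word_cong.trans[of "v @ [(x, \<not> b)] @ (x, b) # u" "v @ u" R "[]"] by (simp add: a)
      then show ?case by blast
    qed
    then obtain v where "(v @ u, []) \<in> word_cong R" by blast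
    then have "word_cong R `` {v} \<otimes>\<^bsub>?G\<^esub> A = \<one>\<^bsub>?G\<^esub>"
      unfolding u presented_group_mult one by (rule equiv_class_eq[OF equiv_word_cong])
    moreover have "word_cong R `` {v} \<in> carrier ?G" unfolding carr by (rule exI) (rule HOL.refl)
    ultimately show ?thesis ..
  qed
qed

section \<open>The groups \<open>G\<^sub>p(m, n)\<close>\<close>

datatype gen = Sigma_gen | Tau_gen

definition Gp_relations :: "nat \<Rightarrow> nat \<Rightarrow> nat \<Rightarrow> (gen word \<times> gen word) set" where
  "Gp_relations p m n =
    (let \<sigma> = (Sigma_gen, True); \<tau> = (Tau_gen, True); \<tau>' = (Tau_gen, False) in
      {(replicate (p ^ m) \<sigma>, []),
       (replicate (p ^ n) \<tau>, []),
       ([\<tau>, \<sigma>, \<tau>'], replicate (1 + p ^ (m - 1)) \<sigma>)})"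

definition Gp :: "nat \<Rightarrow> nat \<Rightarrow> nat \<Rightarrow> gen word set monoid" where
  "Gp p m n = presented_group (Gp_relations p m n)"

end

theory Submission
  imports Defs "HOL-Algebra.Multiplicative_Group" "HOL-Library.Real_Mod"
begin

text \<open>
  On pairs \<open>(a, b)\<close>, standing for \<open>\<sigma>\<^sup>a \<tau>\<^sup>b\<close>, the multiplications of \<open>G\<^sub>p(m, n)\<close> and of the
  abelian group differ by multiples of \<open>z = (p\<^bsup>m - 1\<^esup>, 0)\<close>. A subgroup of either group that contains
  \<open>z\<close> is therefore a subgroup of the other one; a subgroup that does not contain \<open>z\<close> only has elements
  with \<open>p\<close> dividing \<open>a\<close>, and on these the multiplications agree. So the two groups have literally the
  same subgroups. The symmetry is the duality \<open>H \<mapsto> H\<^sup>\<bottom>\<close> of the abelian group, with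
  \<open>|H| |H\<^sup>\<bottom>| = |G|\<close> by orthogonality of characters.

  The zeta function determines the numbers of subgroups of each order. A group of order at most
  \<open>p\<^sup>2\<close>, or of order \<open>8\<close> and exponent greater than \<open>2\<close>, has a metacyclic presentation
  \<open>x\<^sup>a = 1, y\<^sup>b = x\<^sup>c, y x = x\<^sup>d y\<close> with \<open>ab\<close> equal to its order, which fixes the group up to
  isomorphism; the numbers of subgroups of order \<open>p\<close> and \<open>4\<close> tell the parameters apart.
\<close>

section \<open>Finite presentations\<close>

primrec eval_word :: "('g, 'c) monoid_scheme \<Rightarrow> ('a \<Rightarrow> 'g) \<Rightarrow> 'a word \<Rightarrow> 'g" where
  "eval_word G f [] = \<one>\<^bsub>G\<^esub>"
| "eval_word G f (l # w) =
    (if snd l then f (fst l) else inv\<^bsub>G\<^esub> f (fst l)) \<otimes>\<^bsub>G\<^esub> eval_word G f w"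

context group
begin

lemma eval_word_closed [simp]:
  assumes "range f \<subseteq> carrier G"
  shows "eval_word G f w \<in> carrier G"
  using assms by (induction w) auto

lemma eval_word_append:
  assumes "range f \<subseteq> carrier G"
  shows "eval_word G f (u @ v) = eval_word G f u \<otimes> eval_word G f v"
proof (induction u)
  case Nil
  then show ?case using assms by simp
next
  case (Cons l u)
  have "f (fst l) \<in> carrier G" using assms by auto
  then show ?case using Cons assms by (simp add: m_assoc)
qed

lemma eval_word_replicate:
  assumes "range f \<subseteq> carrier G"
  shows "eval_word G f (replicate k (x, True)) = f x [^] k"
proof (induction k)
  case (Suc k)
  have "f x \<in> carrier G" using assms by auto
  then show ?case using Suc nat_pow_Suc2[of "f x" k] by (simp del: nat_pow_Suc Group.nat_pow_Suc)
qed simp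

lemma eval_word_cong:
  assumes f: "range f \<subseteq> carrier G"
    and rel: "\<And>u v. (u, v) \<in> R \<Longrightarrow> eval_word G f u = eval_word G f v"
    and "(u, v) \<in> word_cong R"
  shows "eval_word G f u = eval_word G f v"
  using assms(3)
proof induction
  case (cancel x b)
  have "f x \<in> carrier G" using f by auto
  then show ?case by simp
qed (use f rel in \<open>auto simp: eval_word_append\<close>)

text \<open>Left multiplication by an element of \<open>S\<close> is injective and maps the finite
  set \<open>S\<close> into itself, so it permutes \<open>S\<close>. Solving
  \<open>x \<otimes> e = x\<close> and \<open>x \<otimes> y = \<one>\<close> inside \<open>S\<close>
  yields the unit and inverses.\<close>

lemma subgroup_if_finite_mult_closed:
  assumes "finite S" "S \<noteq> {}" and sub: "S \<subseteq> carrier G"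
    and closed: "\<And>x y. x \<in> S \<Longrightarrow> y \<in> S \<Longrightarrow> x \<otimes> y \<in> S"
  shows "subgroup S G"
proof -
  have surj: "(\<otimes>) x ` S = S" if "x \<in> S" for x
  proof (rule endo_inj_surj)
    show "inj_on ((\<otimes>) x) S" using that sub by (intro inj_on_subset[OF inj_on_cmult]) auto
  qed (use assms that in auto)
  have one: "\<one> \<in> S"
  proof -
    obtain x where x: "x \<in> S" using \<open>S \<noteq> {}\<close> by blast
    then have "x \<in> (\<otimes>) x ` S" using surj by simp
    then obtain e where e: "e \<in> S" "x \<otimes> e = x" by auto
    then have "e = \<one>" using x sub l_cancel_one[of x e] by auto
    with e show ?thesis by simp
  qed
  have "inv x \<in> S" if x: "x \<in> S" for x
  proof -
    have "\<one> \<in> (\<otimes>) x ` S" using surj[OF x] one by simp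
    then obtain y where y: "y \<in> S" "x \<otimes> y = \<one>" by auto
    then have "inv x = y" using x sub inv_equality[OF inv_comm, of x y] by auto
    with y show ?thesis by simp
  qed
  with one show ?thesis using sub closed by unfold_locales auto
qed

end

section \<open>Elements and homomorphisms of presented groups\<close>

lemma carrier_presented_group_subset:
  assumes one: "\<one>\<^bsub>presented_group R\<^esub> \<in> S"
    and step: "\<And>x b A. A \<in> S \<Longrightarrow> word_cong R `` {[(x, b)]} \<otimes>\<^bsub>presented_group R\<^esub> A \<in> S"
  shows "carrier (presented_group R) \<subseteq> S"
proof
  fix A assume "A \<in> carrier (presented_group R)"
  then obtain u where A: "A = word_cong R `` {u}" by (auto simp: presented_group_def quotient_def)
  have "word_cong R `` {u} \<in> S"
  proof (induction u)
    case Nil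
    then show ?case using one by (simp add: presented_group_def)
  next
    case (Cons l u)
    obtain x b where l: "l = (x, b)" by (cases l)
    have "word_cong R `` {[(x, b)]} \<otimes>\<^bsub>presented_group R\<^esub> word_cong R `` {u} \<in> S"
      using Cons by (rule step)
    then show ?case by (simp add: presented_group_mult l)
  qed
  then show "A \<in> S" by (simp add: A)
qed

definition gen_class :: "('a word \<times> 'a word) set \<Rightarrow> 'a \<Rightarrow> 'a word set" where
  "gen_class R x = word_cong R `` {[(x, True)]}"

lemma word_class_closed: "word_cong R `` {u} \<in> carrier (presented_group R)"
  by (auto simp: presented_group_def quotient_def)

lemma gen_class_closed: "range (gen_class R) \<subseteq> carrier (presented_group R)"
  by (auto simp: gen_class_def word_class_closed)

lemma inv_gen_class: "inv\<^bsub>presented_group R\<^esub> gen_class R x = word_cong R `` {[(x, False)]}"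
proof -
  interpret P: group "presented_group R" by (rule group_presented_group)
  have "word_cong R `` {[(x, False), (x, True)]} = word_cong R `` {[]}"
    using word_cong.cancel[of x False R] by (intro equiv_class_eq[OF equiv_word_cong]) simp
  then have "word_cong R `` {[(x, False)]} \<otimes>\<^bsub>presented_group R\<^esub> gen_class R x
      = \<one>\<^bsub>presented_group R\<^esub>"
    by (simp add: gen_class_def presented_group_mult) (simp add: presented_group_def)
  then show ?thesis
    by (rule P.inv_equality) (auto simp: gen_class_def word_class_closed)
qed

lemma eval_gen_class: "eval_word (presented_group R) (gen_class R) u = word_cong R `` {u}"
proof (induction u)
  case (Cons l u)
  obtain x b where l: "l = (x, b)" by (cases l)
  have "eval_word (presented_group R) (gen_class R) (l # u)
      = word_cong R `` {[(x, b)]} \<otimes>\<^bsub>presented_group R\<^esub> word_cong R `` {u}"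
    by (cases b) (simp_all add: Cons.IH l inv_gen_class, simp add: gen_class_def)
  then show ?case by (simp add: presented_group_mult l)
qed (simp add: presented_group_def)

lemma eval_gen_class_rel:
  assumes "(u, v) \<in> R"
  shows "eval_word (presented_group R) (gen_class R) u = eval_word (presented_group R) (gen_class R) v"
  unfolding eval_gen_class using assms
  by (intro equiv_class_eq[OF equiv_word_cong] word_cong.rel)

lemma presented_group_generated:
  assumes K: "subgroup K (presented_group R)" and "range (gen_class R) \<subseteq> K"
  shows "carrier (presented_group R) \<subseteq> K"
proof (rule carrier_presented_group_subset)
  interpret K: subgroup K "presented_group R" by fact
  interpret P: group "presented_group R" by (rule group_presented_group)
  show "\<one>\<^bsub>presented_group R\<^esub> \<in> K" by simp
  fix x b A assume A: "A \<in> K"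
  have "gen_class R x \<in> K" using assms by auto
  then have "word_cong R `` {[(x, b)]} \<in> K"
    by (cases b) (auto simp: gen_class_def inv_gen_class[symmetric] K.m_inv_closed)
  then show "word_cong R `` {[(x, b)]} \<otimes>\<^bsub>presented_group R\<^esub> A \<in> K" using A by simp
qed

text \<open>Von Dyck's argument: an assignment respecting the relations extends to a homomorphism,
  onto because its image is a subgroup containing the generators. The cardinality bound forces
  injectivity, so only an upper bound on the presented group has to be proved.\<close>

lemma presented_group_iso:
  assumes "group G" and f: "range f \<subseteq> carrier G"
    and rel: "\<And>u v. (u, v) \<in> R \<Longrightarrow> eval_word G f u = eval_word G f v"
    and gen: "\<And>K. subgroup K G \<Longrightarrow> range f \<subseteq> K \<Longrightarrow> carrier G \<subseteq> K"
    and fin: "finite (carrier (presented_group R))"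
    and card: "card (carrier (presented_group R)) \<le> order G"
  shows "presented_group R \<cong> G"
proof -
  interpret G: group G by fact
  interpret P: group "presented_group R" by (rule group_presented_group)
  \<comment> \<open>All words in one class have the same value, so the image of a class is a
    singleton.\<close>
  define h where "h A = the_elem (eval_word G f ` A)" for A
  have h: "h (word_cong R `` {u}) = eval_word G f u" for u
  proof -
    have "eval_word G f ` (word_cong R `` {u}) = {eval_word G f u}"
    proof
      show "eval_word G f ` (word_cong R `` {u}) \<subseteq> {eval_word G f u}"
      proof clarify
        fix v assume "(u, v) \<in> word_cong R"
        then show "eval_word G f v = eval_word G f u"
          using G.eval_word_cong[OF f rel] by metis
      qed
    qed (use word_cong.refl[of u R] in auto)
    then show ?thesis by (simp add: h_def)
  qed
  have rep: "\<exists>u. A = word_cong R `` {u}" if "A \<in> carrier (presented_group R)" for A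
    using that by (auto simp: presented_group_def quotient_def)
  have hom: "h \<in> hom (presented_group R) G"
  proof (rule homI)
    fix A B assume "A \<in> carrier (presented_group R)" "B \<in> carrier (presented_group R)"
    then obtain u v where "A = word_cong R `` {u}" "B = word_cong R `` {v}" using rep by metis
    then show "h (A \<otimes>\<^bsub>presented_group R\<^esub> B) = h A \<otimes>\<^bsub>G\<^esub> h B"
      using f by (simp add: presented_group_mult h G.eval_word_append)
  qed (use rep h f in force)
  interpret h: group_hom "presented_group R" G h by unfold_locales (rule hom)
  have surj: "h ` carrier (presented_group R) = carrier G"
  proof
    have "f x \<in> h ` carrier (presented_group R)" for x
    proof -
      have "f x \<in> carrier G" using f by auto
      then have "h (gen_class R x) = f x" by (simp add: gen_class_def h)
      then show ?thesis using gen_class_closed[of R] by (metis image_eqI range_subsetD)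
    qed
    then show "carrier G \<subseteq> h ` carrier (presented_group R)"
      by (intro gen h.img_is_subgroup) auto
  qed (use h.hom_closed in auto)
  have "inj_on h (carrier (presented_group R))"
    using card fin surj card_image_le[OF fin, of h]
    by (intro eq_card_imp_inj_on) (auto simp: order_def)
  with surj hom have "h \<in> iso (presented_group R) G" by (auto simp: iso_def bij_betw_def)
  then show ?thesis by (rule is_isoI)
qed

subsection \<open>Metacyclic groups\<close>

definition metacyclic_relations :: "nat \<Rightarrow> nat \<Rightarrow> nat \<Rightarrow> nat \<Rightarrow> (gen word \<times> gen word) set" where
  "metacyclic_relations a b c d =
    {(replicate a (Sigma_gen, True), []),
     (replicate b (Tau_gen, True), replicate c (Sigma_gen, True)),
     ([(Tau_gen, True), (Sigma_gen, True), (Tau_gen, False)], replicate d (Sigma_gen, True))}"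

lemma Gp_relations_metacyclic:
  "Gp_relations p m n = metacyclic_relations (p ^ m) (p ^ n) 0 (1 + p ^ (m - 1))"
  by (simp add: Gp_relations_def metacyclic_relations_def Let_def)

text \<open>The order is left open; the relations only bound it by \<open>a * b\<close>. Hence the
  presented group is an instance before its size is known, and \<open>order G = a * b\<close> is the
  extra condition under which the parameters fix \<open>G\<close> up to isomorphism.\<close>

locale metacyclic = group G for G (structure) +
  fixes x y :: 'a and a b c d :: nat
  assumes x_closed [simp]: "x \<in> carrier G" and y_closed [simp]: "y \<in> carrier G"
    and a_pos: "0 < a" and b_pos: "0 < b"
    and x_pow: "x [^] a = \<one>" and y_pow: "y [^] b = x [^] c"
    and yx: "y \<otimes> x = x [^] d \<otimes> y"
    and generated: "\<And>K. subgroup K G \<Longrightarrow> x \<in> K \<Longrightarrow> y \<in> K \<Longrightarrow> carrier G \<subseteq> K"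
begin

lemma x_pow_mod: "x [^] (i mod a) = x [^] i"
proof -
  have "x [^] i = x [^] (a * (i div a)) \<otimes> x [^] (i mod a)" by (simp add: nat_pow_mult)
  also have "x [^] (a * (i div a)) = \<one>" by (simp add: nat_pow_pow[symmetric] x_pow)
  finally show ?thesis by simp
qed

lemma y_x_pow: "y \<otimes> x [^] k = x [^] (k * d) \<otimes> y" for k :: nat
proof (induction k)
  case (Suc k)
  have "y \<otimes> x [^] Suc k = (y \<otimes> x [^] k) \<otimes> x" by (simp add: m_assoc)
  also have "\<dots> = x [^] (k * d) \<otimes> (y \<otimes> x)" by (simp add: Suc m_assoc)
  also have "\<dots> = (x [^] (k * d) \<otimes> x [^] d) \<otimes> y" by (simp add: yx m_assoc)
  also have "\<dots> = x [^] (Suc k * d) \<otimes> y" by (simp add: nat_pow_mult add.commute)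
  finally show ?case .
qed simp

lemma y_pow_x_pow: "y [^] j \<otimes> x [^] k = x [^] (k * d ^ j) \<otimes> y [^] j" for j k :: nat
proof (induction j arbitrary: k)
  case (Suc j)
  have "y [^] Suc j \<otimes> x [^] k = y [^] j \<otimes> (y \<otimes> x [^] k)" by (simp add: m_assoc)
  also have "\<dots> = (y [^] j \<otimes> x [^] (k * d)) \<otimes> y" by (simp add: y_x_pow m_assoc)
  also have "\<dots> = x [^] (k * d ^ Suc j) \<otimes> y [^] Suc j" by (simp add: Suc m_assoc mult.assoc)
  finally show ?case .
qed simp

lemma normal_form_mult:
  "(x [^] i \<otimes> y [^] j) \<otimes> (x [^] k \<otimes> y [^] l) = x [^] (i + k * d ^ j) \<otimes> y [^] (j + l)"
  for i j k l :: nat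
proof -
  have "(x [^] i \<otimes> y [^] j) \<otimes> (x [^] k \<otimes> y [^] l) = x [^] i \<otimes> (y [^] j \<otimes> x [^] k) \<otimes> y [^] l"
    by (simp add: m_assoc)
  also have "\<dots> = (x [^] i \<otimes> x [^] (k * d ^ j)) \<otimes> (y [^] j \<otimes> y [^] l)"
    by (simp add: m_assoc y_pow_x_pow)
  finally show ?thesis by (simp add: nat_pow_mult)
qed

lemma normal_form_reduce:
  "x [^] i \<otimes> y [^] j = x [^] ((i + c * (j div b)) mod a) \<otimes> y [^] (j mod b)" for i j :: nat
proof -
  have "y [^] j = y [^] (b * (j div b)) \<otimes> y [^] (j mod b)" by (simp add: nat_pow_mult)
  also have "y [^] (b * (j div b)) = x [^] (c * (j div b))"
    by (simp add: nat_pow_pow[symmetric] y_pow)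
  finally show ?thesis by (simp add: x_pow_mod nat_pow_mult m_assoc[symmetric])
qed

text \<open>The normal forms are closed under multiplication by \<open>normal_form_mult\<close>, and
  there are finitely many after reduction; so they form a subgroup containing both
  generators.\<close>

lemma carrier_eq: "carrier G = (\<lambda>(i, j). x [^] i \<otimes> y [^] j) ` ({..<a} \<times> {..<b})"
proof -
  let ?S = "(\<lambda>(i, j). x [^] i \<otimes> y [^] j) ` ({..<a} \<times> {..<b})"
  have mem: "x [^] i \<otimes> y [^] j \<in> ?S" for i j :: nat
    by (subst normal_form_reduce, rule image_eqI[of _ _ "((i + c * (j div b)) mod a, j mod b)"])
       (use a_pos b_pos in auto)
  have "subgroup ?S G"
  proof (rule subgroup_if_finite_mult_closed)
    fix u v assume "u \<in> ?S" "v \<in> ?S"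
    then show "u \<otimes> v \<in> ?S" using mem by (auto simp: normal_form_mult)
  qed (use mem in auto)
  moreover have "x \<in> ?S" using mem[of 1 0] by simp
  moreover have "y \<in> ?S" using mem[of 0 1] by simp
  ultimately show ?thesis using generated[of ?S] by auto
qed

lemma finite_carrier: "finite (carrier G)"
  by (subst carrier_eq) simp

lemma order_le: "order G \<le> a * b"
  unfolding order_def by (subst carrier_eq) (metis card_cartesian_product card_image_le card_lessThan
    finite_SigmaI finite_lessThan)

lemma inj_on_normal_form:
  assumes "order G = a * b"
  shows "inj_on (\<lambda>(i, j). x [^] i \<otimes> y [^] j) ({..<a} \<times> {..<b})"
proof (rule eq_card_imp_inj_on)
  show "card ((\<lambda>(i, j). x [^] i \<otimes> y [^] j) ` ({..<a} \<times> {..<b})) = card ({..<a} \<times> {..<b})"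
    using assms unfolding carrier_eq[symmetric] order_def by simp
qed simp

end

lemma metacyclic_presented_group:
  assumes "0 < a" "0 < b" and R: "R = metacyclic_relations a b c d"
  shows "metacyclic (presented_group R) (gen_class R Sigma_gen) (gen_class R Tau_gen) a b c d"
proof -
  let ?P = "presented_group R"
  let ?x = "gen_class R Sigma_gen" and ?y = "gen_class R Tau_gen"
  interpret P: group ?P by (rule group_presented_group)
  have cl [simp]: "gen_class R g \<in> carrier ?P" for g using gen_class_closed[of R] by auto
  note ev = P.eval_word_replicate[OF gen_class_closed]
  show ?thesis
  proof
    have R1: "(replicate a (Sigma_gen, True), []) \<in> R"
      and R2: "(replicate b (Tau_gen, True), replicate c (Sigma_gen, True)) \<in> R"
      and R3: "([(Tau_gen, True), (Sigma_gen, True), (Tau_gen, False)], replicate d (Sigma_gen, True)) \<in> R"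
      by (simp_all add: R metacyclic_relations_def)
    show "?x [^]\<^bsub>?P\<^esub> a = \<one>\<^bsub>?P\<^esub>"
      using eval_gen_class_rel[OF R1] by (simp add: ev)
    show "?y [^]\<^bsub>?P\<^esub> b = ?x [^]\<^bsub>?P\<^esub> c"
      using eval_gen_class_rel[OF R2] by (simp add: ev)
    have "?y \<otimes>\<^bsub>?P\<^esub> (?x \<otimes>\<^bsub>?P\<^esub> inv\<^bsub>?P\<^esub> ?y) = ?x [^]\<^bsub>?P\<^esub> d"
      using eval_gen_class_rel[OF R3] by (simp add: ev)
    then have "?x [^]\<^bsub>?P\<^esub> d = (?y \<otimes>\<^bsub>?P\<^esub> ?x) \<otimes>\<^bsub>?P\<^esub> inv\<^bsub>?P\<^esub> ?y"
      by (simp add: P.m_assoc)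
    then show "?y \<otimes>\<^bsub>?P\<^esub> ?x = ?x [^]\<^bsub>?P\<^esub> d \<otimes>\<^bsub>?P\<^esub> ?y"
      by (subst (asm) P.inv_solve_right) auto
    fix K assume K: "subgroup K ?P" "?x \<in> K" "?y \<in> K"
    have "gen_class R g \<in> K" for g using K by (cases g) auto
    then show "carrier ?P \<subseteq> K" by (intro presented_group_generated[OF K(1)]) auto
  qed (use assms(1,2) in auto)
qed

text \<open>The presented group is itself an instance of the locale, so it has at most
  \<open>a * b\<close> elements, the exact order of \<open>G\<close>.\<close>

lemma (in metacyclic) presented_group_iso_metacyclic:
  assumes "order G = a * b"
  shows "presented_group (metacyclic_relations a b c d) \<cong> G"
proof -
  interpret P: metacyclic "presented_group (metacyclic_relations a b c d)"
    "gen_class (metacyclic_relations a b c d) Sigma_gen"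
    "gen_class (metacyclic_relations a b c d) Tau_gen"
    by (rule metacyclic_presented_group[OF a_pos b_pos HOL.refl])
  let ?f = "\<lambda>g. case g of Sigma_gen \<Rightarrow> x | Tau_gen \<Rightarrow> y"
  have f: "range ?f \<subseteq> carrier G" by (auto split: gen.split)
  show ?thesis
  proof (rule presented_group_iso[OF is_group f])
    fix u v assume "(u, v) \<in> metacyclic_relations a b c d"
    moreover have "y \<otimes> (x \<otimes> inv y) = x [^] d"
      by (simp add: m_assoc[symmetric] yx) (simp add: m_assoc)
    ultimately show "eval_word G ?f u = eval_word G ?f v"
      by (auto simp: metacyclic_relations_def eval_word_replicate[OF f] x_pow y_pow)
  next
    fix K assume "subgroup K G" "range ?f \<subseteq> K"
    moreover from this have "?f Sigma_gen \<in> K" "?f Tau_gen \<in> K" by blast+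
    ultimately show "carrier G \<subseteq> K" by (intro generated) auto
  next
    show "card (carrier (presented_group (metacyclic_relations a b c d))) \<le> order G"
      using P.order_le assms by (simp add: order_def)
  qed (rule P.finite_carrier)
qed

lemma metacyclic_iso:
  assumes "metacyclic G x y a b c d" "metacyclic G' x' y' a b c d"
    and "order G = a * b" "order G' = a * b"
  shows "G' \<cong> G"
  using assms metacyclic.presented_group_iso_metacyclic
  by (metis group.iso_sym group_presented_group iso_trans)

section \<open>Zeta functions of finite groups\<close>

lemma finite_subgroups:
  assumes "finite (carrier G)"
  shows "finite {H. subgroup H G}"
  by (rule finite_subset[of _ "Pow (carrier G)"]) (use assms in \<open>auto dest: subgroup.subset\<close>)

lemma num_subgroups_le_iso:
  assumes "group G" "group H" and iso: "G \<cong> H" and fin: "finite (carrier H)"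
  shows "num_subgroups k G \<le> num_subgroups k H"
proof -
  obtain h where h: "h \<in> iso G H" using iso by (auto simp: is_iso_def)
  then have inj: "inj_on h (carrier G)" by (auto simp: iso_def bij_betw_def)
  interpret h: group_hom G H h
    using assms h by (auto simp: group_hom_def group_hom_axioms_def iso_def)
  have sub: "K \<subseteq> carrier G" if "subgroup K G" for K using that by (rule subgroup.subset)
  show ?thesis unfolding num_subgroups_def
  proof (rule card_inj_on_le)
    show "inj_on ((`) h) {K. subgroup K G \<and> card K = k}"
      by (rule inj_onI) (simp add: inj_on_image_eq_iff[OF inj] sub)
    show "(`) h ` {K. subgroup K G \<and> card K = k} \<subseteq> {K. subgroup K H \<and> card K = k}"
      using sub h.subgroup_img_is_subgroup by (auto simp: card_image inj_on_subset[OF inj])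
    show "finite {K. subgroup K H \<and> card K = k}"
      using finite_subgroups[OF fin] by (rule rev_finite_subset) auto
  qed
qed

lemma num_subgroups_iso:
  assumes "group G" "group H" and iso: "G \<cong> H" and fin: "finite (carrier H)"
  shows "num_subgroups k G = num_subgroups k H"
  using num_subgroups_le_iso[OF assms] iso_finite[OF iso] fin
    num_subgroups_le_iso[OF \<open>group H\<close> \<open>group G\<close> group.iso_sym[OF \<open>group G\<close> iso]]
  by (metis le_antisym)

lemma group_zeta_iso:
  assumes "group G" "group H" "G \<cong> H" "finite (carrier H)"
  shows "group_zeta G = group_zeta H"
  by (rule ext) (simp add: group_zeta_def num_subgroups_iso[OF assms])

text \<open>These values are power sums of the subgroup orders; they alone serve to recover the
  counts.\<close>

lemma group_zeta_minus_of_nat: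
  assumes "group G" and fin: "finite (carrier G)"
  shows "group_zeta G (- of_nat j) = (\<Sum>H | subgroup H G. of_nat (card H) ^ j)"
  unfolding group_zeta_eq_sum_subgroups[OF assms]
proof (rule sum.cong)
  fix H assume "H \<in> {H. subgroup H G}"
  then have "0 < card H" using subgroup.finite_imp_card_positive[OF _ fin] by auto
  then show "of_nat (card H) powr (- (- of_nat j) :: complex) = of_nat (card H) ^ j"
    by (simp add: powr_nat')
qed simp

text \<open>Equal power sums give equal sums of any polynomial in the values; the product
  \<open>\<Prod>l\<in>L. X - l\<close> over all other values \<open>l\<close> selects the value \<open>k\<close>.\<close>

lemma power_sum_prod_insert:
  fixes f :: "'a \<Rightarrow> complex"
  assumes "finite L" "l \<notin> L"
  shows "(\<Sum>x\<in>S. f x ^ j * (\<Prod>l\<in>insert l L. f x - l)) =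
    (\<Sum>x\<in>S. f x ^ Suc j * (\<Prod>l\<in>L. f x - l)) - l * (\<Sum>x\<in>S. f x ^ j * (\<Prod>l\<in>L. f x - l))"
  unfolding sum_distrib_left sum_subtractf[symmetric]
  by (rule sum.cong) (use assms in \<open>simp_all add: algebra_simps\<close>)

lemma sum_prod_select:
  fixes f :: "'a \<Rightarrow> complex"
  assumes "finite S" "finite L" "f ` S \<subseteq> insert k L"
  shows "(\<Sum>x\<in>S. \<Prod>l\<in>L. f x - l) = of_nat (card {x \<in> S. f x = k}) * (\<Prod>l\<in>L. k - l)"
proof -
  have "(\<Sum>x\<in>S. \<Prod>l\<in>L. f x - l) = (\<Sum>x\<in>S. if f x = k then \<Prod>l\<in>L. k - l else 0)"
    using assms by (intro sum.cong) (auto intro!: prod_zero)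
  then show ?thesis
    using assms by (simp add: sum.If_cases Int_def)
qed

lemma card_fibre_eq_if_power_sums_eq:
  fixes f :: "'a \<Rightarrow> complex" and g :: "'b \<Rightarrow> complex"
  assumes "finite S" "finite T" and eq: "\<And>j. (\<Sum>x\<in>S. f x ^ j) = (\<Sum>y\<in>T. g y ^ j)"
  shows "card {x \<in> S. f x = k} = card {y \<in> T. g y = k}"
proof -
  \<comment> \<open>The weight \<open>f x ^ j\<close> is carried along because multiplying out a
    factor \<open>f x - l\<close> raises the exponent.\<close>
  have pw: "(\<Sum>x\<in>S. f x ^ j * (\<Prod>l\<in>L. f x - l)) = (\<Sum>y\<in>T. g y ^ j * (\<Prod>l\<in>L. g y - l))"
    if "finite L" for L j
    using that
  proof (induction L arbitrary: j rule: finite_induct)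
    case (insert l L)
    show ?case
      unfolding power_sum_prod_insert[OF insert.hyps] by (simp only: insert.IH)
  qed (simp add: eq)
  define L where "L = f ` S \<union> g ` T - {k}"
  have "finite L" using assms by (simp add: L_def)
  then have "of_nat (card {x \<in> S. f x = k}) * (\<Prod>l\<in>L. k - l) =
      of_nat (card {y \<in> T. g y = k}) * (\<Prod>l\<in>L. k - l)"
    using pw[of L 0] sum_prod_select[of S L f k] sum_prod_select[of T L g k] assms
    by (simp add: L_def subset_iff)
  moreover have "(\<Prod>l\<in>L. k - l) \<noteq> 0" using \<open>finite L\<close> by (auto simp: L_def)
  ultimately show ?thesis by simp
qed

lemma num_subgroups_eq_if_group_zeta_eq:
  assumes "group G" "finite (carrier G)" "group G'" "finite (carrier G')"
    and zeta: "group_zeta G' = group_zeta G"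
  shows "num_subgroups k G' = num_subgroups k G"
proof -
  have "card {H \<in> {H. subgroup H G'}. of_nat (card H) = (of_nat k :: complex)} =
      card {H \<in> {H. subgroup H G}. of_nat (card H) = (of_nat k :: complex)}"
  proof (rule card_fibre_eq_if_power_sums_eq)
    show "(\<Sum>H | subgroup H G'. of_nat (card H) ^ j) = (\<Sum>H | subgroup H G. of_nat (card H) ^ j :: complex)"
      for j
      using fun_cong[OF zeta, of "- of_nat j"]
      unfolding group_zeta_minus_of_nat[OF assms(1,2)] group_zeta_minus_of_nat[OF assms(3,4)] .
  qed (use assms finite_subgroups in auto)
  then show ?thesis by (simp add: num_subgroups_def)
qed

text \<open>\<open>G\<close> is a subgroup of itself, so \<open>G'\<close> must also have a subgroup
  of order \<open>order G\<close>.\<close>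

lemma order_le_if_group_zeta_eq:
  assumes "group G" "finite (carrier G)" "group G'" "finite (carrier G')"
    and "group_zeta G' = group_zeta G"
  shows "order G \<le> order G'"
proof -
  have "carrier G \<in> {H. subgroup H G \<and> card H = order G}"
    using group.subgroup_self[OF \<open>group G\<close>] by (simp add: order_def)
  moreover have "finite {H. subgroup H G \<and> card H = order G}"
    using finite_subgroups[OF \<open>finite (carrier G)\<close>] by (rule rev_finite_subset) auto
  ultimately have "num_subgroups (order G) G \<noteq> 0" by (auto simp: num_subgroups_def)
  then have "{H. subgroup H G' \<and> card H = order G} \<noteq> {}"
    using num_subgroups_eq_if_group_zeta_eq[OF assms] by (metis card.empty num_subgroups_def)
  then obtain H where "subgroup H G'" "card H = order G" by auto
  then show ?thesis
    using card_mono[OF \<open>finite (carrier G')\<close> subgroup.subset] by (metis order_def)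
qed

lemma order_eq_if_group_zeta_eq:
  assumes "group G" "finite (carrier G)" "group G'" "finite (carrier G')"
    and "group_zeta G' = group_zeta G"
  shows "order G' = order G"
  using order_le_if_group_zeta_eq[of G G'] order_le_if_group_zeta_eq[of G' G] assms by simp

section \<open>Duality for products of two cyclic groups\<close>

text \<open>Translation by some \<open>g\<close> with \<open>\<phi> g \<noteq> 1\<close> permutes
  \<open>K\<close> and multiplies the sum by \<open>\<phi> g\<close>, so the sum vanishes.\<close>

lemma (in group) sum_character:
  fixes \<phi> :: "'a \<Rightarrow> complex"
  assumes K: "subgroup K G" and fin: "finite K"
    and mult: "\<And>x y. x \<in> K \<Longrightarrow> y \<in> K \<Longrightarrow> \<phi> (x \<otimes> y) = \<phi> x * \<phi> y"
  shows "(\<Sum>x\<in>K. \<phi> x) = (if \<forall>x\<in>K. \<phi> x = 1 then of_nat (card K) else 0)"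
proof (cases "\<forall>x\<in>K. \<phi> x = 1")
  case False
  interpret K: subgroup K G by fact
  obtain g where g: "g \<in> K" "\<phi> g \<noteq> 1" using False by blast
  have "bij_betw ((\<otimes>) g) K K"
    by (rule bij_betwI[where g = "\<lambda>x. inv g \<otimes> x"]) (use g in \<open>auto simp: m_assoc[symmetric]\<close>)
  from sum.reindex_bij_betw[OF this, of \<phi>]
  have "\<phi> g * (\<Sum>x\<in>K. \<phi> x) = (\<Sum>x\<in>K. \<phi> x)"
    using g mult by (simp add: sum_distrib_left)
  then have "(\<phi> g - 1) * (\<Sum>x\<in>K. \<phi> x) = 0" by (simp add: algebra_simps)
  then have "(\<Sum>x\<in>K. \<phi> x) = 0" using g by simp
  then show ?thesis by (simp only: False if_False)
qed simp

definition root_char :: "nat \<Rightarrow> int \<Rightarrow> complex" where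
  "root_char N k = cis (2 * pi * of_int k / of_nat N)"

lemma root_char_add: "root_char N (k + l) = root_char N k * root_char N l"
  by (simp add: root_char_def cis_mult ring_distribs add_divide_distrib)

lemma root_char_eq_1_iff:
  assumes "0 < N"
  shows "root_char N k = 1 \<longleftrightarrow> int N dvd k"
proof -
  have "root_char N k = 1 \<longleftrightarrow> (\<exists>n::int. 2 * pi * of_int k / of_nat N = of_int n * (2 * pi))"
    by (simp add: root_char_def cis_eq_1_iff)
  also have "\<dots> \<longleftrightarrow> (\<exists>n::int. real_of_int k = of_int (n * int N))"
    using assms by (intro ex_cong1) (simp add: field_simps)
  also have "\<dots> \<longleftrightarrow> int N dvd k"
    unfolding of_int_eq_iff by (auto simp: dvd_def mult.commute)
  finally show ?thesis .
qed

lemma root_char_cong: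
  assumes "0 < N" "int N dvd k - l"
  shows "root_char N k = root_char N l"
  using root_char_add[of N "k - l" l] root_char_eq_1_iff[of N "k - l"] assms by simp

locale cyclic_pair =
  fixes N L e :: nat
  assumes N_pos: "0 < N" and N_eq: "N = L * e"
begin

definition "A = integer_mod_group N \<times>\<times> integer_mod_group L"

lemma L_pos: "0 < L" and e_pos: "0 < e"
  using N_pos N_eq by (auto intro: Nat.gr0I)

lemma group_A: "group A"
  by (simp add: A_def DirProd_group)

lemma carrier_A: "carrier A = {0..<int N} \<times> {0..<int L}"
  using N_pos L_pos by (simp add: A_def carrier_integer_mod_group)

lemma mult_A: "x \<otimes>\<^bsub>A\<^esub> y = ((fst x + fst y) mod int N, (snd x + snd y) mod int L)"
  by (simp add: A_def DirProd_def split_beta)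

lemma one_A: "\<one>\<^bsub>A\<^esub> = (0, 0)"
  by (simp add: A_def)

lemma finite_A: "finite (carrier A)"
  by (simp add: carrier_A)

lemma order_A: "order A = N * L"
  by (simp add: order_def carrier_A card_cartesian_product)

text \<open>The factor \<open>e\<close> embeds residues modulo \<open>L\<close> into residues modulo
  \<open>N\<close>, so both coordinates contribute well-defined residues modulo \<open>N\<close>;
  fixing one argument and applying \<open>root_char N\<close> gives a character of
  \<open>A\<close>.\<close>

definition pairing :: "int \<times> int \<Rightarrow> int \<times> int \<Rightarrow> int" where
  "pairing x y = fst x * fst y + int e * (snd x * snd y)"

lemma pairing_commute: "pairing x y = pairing y x"
  by (simp add: pairing_def mult.commute)

lemma pairing_mult: "int N dvd pairing x (y \<otimes>\<^bsub>A\<^esub> z) - (pairing x y + pairing x z)"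
proof -
  have "\<exists>k. (fst y + fst z) mod int N = fst y + fst z + int N * k"
    by (metis add.commute cancel_ab_semigroup_add_class.add_diff_cancel_left' minus_mult_div_eq_mod mult_minus_right uminus_add_conv_diff)
  then obtain k where k: "(fst y + fst z) mod int N = fst y + fst z + int N * k" ..
  have "\<exists>k. (snd y + snd z) mod int L = snd y + snd z + int L * k"
    by (metis add.commute cancel_ab_semigroup_add_class.add_diff_cancel_left' minus_mult_div_eq_mod mult_minus_right uminus_add_conv_diff)
  then obtain l where l: "(snd y + snd z) mod int L = snd y + snd z + int L * l" ..
  have "pairing x (y \<otimes>\<^bsub>A\<^esub> z) - (pairing x y + pairing x z) = int N * (fst x * k + snd x * l)"
    by (simp add: pairing_def mult_A k l) (simp add: N_eq algebra_simps)
  then show ?thesis by simp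
qed

lemma root_char_pairing_mult:
  "root_char N (pairing x (y \<otimes>\<^bsub>A\<^esub> z)) = root_char N (pairing x y) * root_char N (pairing x z)"
  using root_char_cong[OF N_pos pairing_mult] by (simp add: root_char_add)

lemma pairing_nondegenerate:
  assumes x: "x \<in> carrier A" and "\<And>y. y \<in> carrier A \<Longrightarrow> int N dvd pairing x y"
  shows "x = (0, 0)"
proof -
  \<comment> \<open>The tests are against the two generators; \<open>1 mod int N\<close> and
    \<open>1 mod int L\<close> stay in the carrier even when a modulus is 1.\<close>
  have "int N dvd fst x * (1 mod int N)"
    using assms(2)[of "(1 mod int N, 0)"] N_pos L_pos by (simp add: carrier_A pairing_def)
  then have "int N dvd fst x" by (metis dvd_eq_mod_eq_0 mod_mult_right_eq mult.right_neutral)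
  moreover have "int N dvd int e * (snd x * (1 mod int L))"
    using assms(2)[of "(0, 1 mod int L)"] N_pos L_pos by (simp add: carrier_A pairing_def)
  then have "int L dvd snd x * (1 mod int L)" using e_pos by (simp add: N_eq mult.commute)
  then have "int L dvd snd x" by (metis dvd_eq_mod_eq_0 mod_mult_right_eq mult.right_neutral)
  ultimately show ?thesis using x zdvd_not_zless[of "fst x" "int N"] zdvd_not_zless[of "snd x" "int L"]
    by (cases x) (force simp: carrier_A)
qed

definition perp :: "(int \<times> int) set \<Rightarrow> (int \<times> int) set" where
  "perp H = {y \<in> carrier A. \<forall>x\<in>H. int N dvd pairing x y}"

lemma subgroup_perp: "subgroup (perp H) A"
proof -
  interpret A: group A by (rule group_A)
  show ?thesis
  proof (rule A.subgroup_if_finite_mult_closed)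
    show "finite (perp H)" using finite_A by (simp add: perp_def)
    have "(0, 0) \<in> perp H" using A.one_closed by (simp add: perp_def one_A pairing_def)
    then show "perp H \<noteq> {}" by blast
    show "x \<otimes>\<^bsub>A\<^esub> y \<in> perp H" if "x \<in> perp H" "y \<in> perp H" for x y
    proof -
      have "int N dvd pairing z (x \<otimes>\<^bsub>A\<^esub> y)" if "z \<in> H" for z
        using that \<open>x \<in> perp H\<close> \<open>y \<in> perp H\<close> pairing_mult[of z x y]
        by (metis (no_types, lifting) diff_add_cancel dvd_add mem_Collect_eq perp_def)
      then show ?thesis using that A.m_closed by (simp add: perp_def)
    qed
  qed (auto simp: perp_def)
qed

text \<open>Double counting of a character sum over \<open>H\<close> and \<open>carrier A\<close>:
  summing over \<open>A\<close> first leaves only \<open>x = (0, 0)\<close> and gives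
  \<open>N * L\<close>; summing over \<open>H\<close> first leaves only
  \<open>y \<in> perp H\<close>.\<close>

lemma card_perp:
  assumes H: "subgroup H A"
  shows "card (perp H) * card H = N * L"
proof -
  interpret A: group A by (rule group_A)
  interpret H: subgroup H A by fact
  let ?\<phi> = "\<lambda>x y. root_char N (pairing x y)"
  have finH: "finite H" using finite_A by (rule rev_finite_subset) (rule H.subset)
  have inner: "(\<Sum>y\<in>carrier A. ?\<phi> x y) = (if x = (0, 0) then of_nat (N * L) else 0)" if "x \<in> H" for x
  proof -
    have "(\<forall>y\<in>carrier A. ?\<phi> x y = 1) \<longleftrightarrow> x = (0, 0)"
      using pairing_nondegenerate[of x] H.subset that
      by (auto simp: root_char_eq_1_iff[OF N_pos]) (auto simp: pairing_def)
    then show ?thesis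
      using A.sum_character[OF A.subgroup_self finite_A, of "?\<phi> x"] root_char_pairing_mult order_A
      by (simp add: order_def)
  qed
  have outer: "(\<Sum>x\<in>H. ?\<phi> x y) = (if y \<in> perp H then of_nat (card H) else 0)" if "y \<in> carrier A" for y
  proof -
    have "(\<forall>x\<in>H. ?\<phi> x y = 1) \<longleftrightarrow> y \<in> perp H"
      using that by (simp add: root_char_eq_1_iff[OF N_pos] perp_def)
    then show ?thesis
      using A.sum_character[OF H finH, of "\<lambda>x. ?\<phi> x y"] root_char_pairing_mult[of y]
      by (simp add: pairing_commute[of _ y])
  qed
  have "(0, 0) \<in> H" using H.one_closed by (simp add: one_A)
  then have "of_nat (N * L) = (\<Sum>x\<in>H. \<Sum>y\<in>carrier A. ?\<phi> x y)"
    using finH by (simp add: inner)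
  also have "\<dots> = (\<Sum>y\<in>carrier A. \<Sum>x\<in>H. ?\<phi> x y)" by (rule sum.swap)
  also have "\<dots> = (\<Sum>y\<in>carrier A. if y \<in> perp H then of_nat (card H) else 0)"
    using outer by (intro sum.cong) auto
  also have "\<dots> = of_nat (card (perp H) * card H)"
    using finite_A by (simp add: sum.If_cases perp_def Int_def)
  finally show ?thesis unfolding of_nat_eq_iff by simp
qed

text \<open>One inclusion is the symmetry of the pairing; \<open>card_perp\<close> for
  \<open>H\<close> and for \<open>perp H\<close> gives equal sizes.\<close>

lemma perp_perp:
  assumes H: "subgroup H A"
  shows "perp (perp H) = H"
proof (rule card_subset_eq[symmetric])
  show "finite (perp (perp H))" using finite_A by (simp add: perp_def)
  show "H \<subseteq> perp (perp H)"
    using subgroup.subset[OF H] by (auto simp: perp_def pairing_commute)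
  have "card (perp (perp H)) * card (perp H) = card H * card (perp H)"
    using card_perp[OF H] card_perp[OF subgroup_perp[of H]] by (simp add: mult.commute)
  moreover have "card (perp H) \<noteq> 0" using card_perp[OF H] N_pos L_pos by (metis mult_eq_0_iff not_gr0)
  ultimately show "card H = card (perp (perp H))" by simp
qed

lemma group_zeta_symmetry: "group_zeta A s = of_nat (N * L) powr (- s) * group_zeta A (- s)"
proof -
  have "bij_betw perp {H. subgroup H A} {H. subgroup H A}"
    by (rule bij_betwI[where g = perp]) (auto simp: subgroup_perp perp_perp)
  from sum.reindex_bij_betw[OF this, of "\<lambda>H. of_nat (card H) powr (- s)"]
  have "group_zeta A s = (\<Sum>H | subgroup H A. of_nat (card (perp H)) powr (- s))"
    by (simp add: group_zeta_eq_sum_subgroups[OF group_A finite_A])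
  also have "\<dots> = (\<Sum>H | subgroup H A. of_nat (N * L) powr (- s) * of_nat (card H) powr s)"
  proof (rule sum.cong)
    fix H assume "H \<in> {H. subgroup H A}"
    then have c: "card (perp H) * card H = N * L" using card_perp by simp
    then have h: "card H \<noteq> 0" using N_pos L_pos by (metis mult_eq_0_iff not_gr0)
    \<comment> \<open>The complex power splits because both bases are non-negative reals.\<close>
    have "(of_nat (N * L) :: complex) powr (- s) = of_nat (card (perp H)) powr (- s) * of_nat (card H) powr (- s)"
      unfolding c[symmetric] of_nat_mult by (rule powr_times_real) auto
    then have "of_nat (N * L) powr (- s) * of_nat (card H) powr s =
        of_nat (card (perp H)) powr (- s) * (of_nat (card H) powr (- s) * of_nat (card H) powr s)"
      by simp
    also have "of_nat (card H) powr (- s) * of_nat (card H) powr s = (1 :: complex)"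
      using h by (simp add: powr_add[symmetric])
    finally show "of_nat (card (perp H)) powr (- s) = of_nat (N * L) powr (- s) * of_nat (card H) powr s"
      by simp
  qed simp
  finally show ?thesis
    by (simp add: group_zeta_eq_sum_subgroups[OF group_A finite_A] sum_distrib_left)
qed

end

section \<open>The groups \<open>G\<^sub>p(m, n)\<close>\<close>

lemma (in group) subgroup_nat_pow_closed:
  assumes "subgroup K G" "x \<in> K"
  shows "x [^] (k :: nat) \<in> K"
proof -
  interpret K: subgroup K G by fact
  show ?thesis using assms(2) by (induction k) auto
qed

text \<open>Trades a remainder for an explicit multiple of the modulus, so that the congruences
  below become polynomial identities.\<close>

lemma mod_int_ex: "\<exists>k. (a :: int) mod n = a + n * k"
  by (rule exI[of _ "- (a div n)"]) (simp add: minus_mult_div_eq_mod)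

text \<open>This kills the binomial term of \<open>pow_T\<close> for exponents
  \<open>p ^ (m - 1) * k\<close>. For odd \<open>p\<close>, 2 is invertible modulo \<open>p\<close>;
  for \<open>p = 2\<close> halving costs one factor, and \<open>3 \<le> m\<close> supplies a
  second.\<close>

lemma prime_dvd_choose_two:
  fixes p m k :: nat
  assumes "prime p" "2 \<le> m" "p = 2 \<longrightarrow> 3 \<le> m"
  shows "p dvd (p ^ (m - 1) * k) choose 2"
proof -
  let ?n = "p ^ (m - 1) * k"
  have C: "2 * (?n choose 2) = ?n * (?n - 1)"
    unfolding choose_two by (rule dvd_mult_div_cancel) (cases ?n; simp)
  show ?thesis
  proof (cases "p = 2")
    case True
    then have "p ^ 2 dvd p ^ (m - 1)" using assms by (intro le_imp_power_dvd) auto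
    then have "p ^ 2 dvd 2 * (?n choose 2)" unfolding C by (intro dvd_mult2)
    then show ?thesis using True by (simp add: power2_eq_square)
  next
    case False
    have "p dvd p ^ (m - 1)" using assms by (intro dvd_power) auto
    then have "p dvd 2 * (?n choose 2)" unfolding C by (intro dvd_mult2)
    moreover have "coprime p 2"
      using primes_coprime[of p 2] False \<open>prime p\<close> by simp
    ultimately show ?thesis by (simp add: coprime_dvd_mult_right_iff)
  qed
qed

locale twisted_product =
  fixes p m n :: nat
  assumes p: "prime p" and n: "1 \<le> n" and nm: "n < m" and two: "p = 2 \<longrightarrow> 3 \<le> m"
begin

definition "N = int p ^ m"
definition "L = int p ^ n"
definition "z = int p ^ (m - 1)"

text \<open>The coordinates \<open>(a, b)\<close> stand for \<open>\<sigma>\<^sup>a \<tau>\<^sup>b\<close>: the value \<open>t = 1\<close> gives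
  \<open>G\<^sub>p(m, n)\<close>, because \<open>(1 + p\<^bsup>m - 1\<^esup>)\<^sup>b \<equiv> 1 + b p\<^bsup>m - 1\<^esup>\<close> modulo \<open>p\<^sup>m\<close>, and
  \<open>t = 0\<close> gives the abelian group.\<close>

definition T :: "int \<Rightarrow> (int \<times> int) monoid" where
  "T t = \<lparr>carrier = {0..<N} \<times> {0..<L},
    monoid.mult = (\<lambda>x y. ((fst x + fst y + t * snd x * fst y * z) mod N, (snd x + snd y) mod L)),
    one = (0, 0)\<rparr>"

lemma carrier_T: "carrier (T t) = {0..<N} \<times> {0..<L}"
  and mult_T: "x \<otimes>\<^bsub>T t\<^esub> y = ((fst x + fst y + t * snd x * fst y * z) mod N, (snd x + snd y) mod L)"
  and one_T: "\<one>\<^bsub>T t\<^esub> = (0, 0)"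
  by (simp_all add: T_def)

lemma p_gt_1: "1 < int p" using prime_gt_1_nat[OF p] by simp

lemma N_gt_1: "1 < N" and L_gt_1: "1 < L" and z_gt_1: "1 < z"
  using p_gt_1 n nm by (auto simp: N_def L_def z_def intro!: one_less_power)

lemma N_eq: "N = z * int p"
  using nm by (simp add: N_def z_def power_eq_if)

text \<open>As \<open>2 \<le> m\<close>, a twist of a twist vanishes modulo
  \<open>N\<close>.\<close>

lemma N_dvd_zz: "N dvd z * z"
  unfolding N_def z_def power_add[symmetric] using n nm by (intro le_imp_power_dvd) auto

text \<open>As \<open>1 \<le> n\<close>, reducing a second coordinate modulo \<open>L\<close> does
  not change the twist modulo \<open>N\<close>.\<close>

lemma N_dvd_Lz: "N dvd L * z"
  unfolding N_def z_def L_def power_add[symmetric] using n nm by (intro le_imp_power_dvd) auto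

text \<open>As \<open>n < m\<close>, an exponent divisible by \<open>z\<close> kills the second
  coordinate.\<close>

lemma L_dvd_z: "L dvd z"
  unfolding z_def L_def using nm by (intro le_imp_power_dvd) auto

lemma group_T: "group (T t)"
proof (rule groupI)
  show "x \<otimes>\<^bsub>T t\<^esub> y \<in> carrier (T t)" for x y
    using N_gt_1 L_gt_1 by (simp add: mult_T carrier_T)
  show "\<one>\<^bsub>T t\<^esub> \<in> carrier (T t)"
    using N_gt_1 L_gt_1 by (simp add: one_T carrier_T)
  show "\<one>\<^bsub>T t\<^esub> \<otimes>\<^bsub>T t\<^esub> x = x" if "x \<in> carrier (T t)" for x
    using that by (auto simp: one_T mult_T carrier_T)
  show "x \<otimes>\<^bsub>T t\<^esub> y \<otimes>\<^bsub>T t\<^esub> w = x \<otimes>\<^bsub>T t\<^esub> (y \<otimes>\<^bsub>T t\<^esub> w)" for x y w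
  proof -
    let ?u = "fst x + fst y + t * snd x * fst y * z" and ?v = "fst y + fst w + t * snd y * fst w * z"
    obtain k1 where k1: "?u mod N = ?u + N * k1" using mod_int_ex by blast
    obtain k2 where k2: "?v mod N = ?v + N * k2" using mod_int_ex by blast
    obtain k3 where k3: "(snd x + snd y) mod L = snd x + snd y + L * k3" using mod_int_ex by blast
    obtain k4 where k4: "z * z = N * k4" using N_dvd_zz by blast
    obtain k5 where k5: "L * z = N * k5" using N_dvd_Lz by blast
    \<comment> \<open>Both bracketings contain the same first-order twists; what remains are
      multiples of \<open>N\<close> from the reductions, a term in \<open>L * z\<close> and a term
      in \<open>z * z\<close>.\<close>
    have "(?u mod N + fst w + t * ((snd x + snd y) mod L) * fst w * z) -
        (fst x + ?v mod N + t * snd x * (?v mod N) * z) =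
        N * k1 + t * k3 * fst w * (L * z) - N * k2 - t * snd x * N * k2 * z -
        t * t * snd x * snd y * fst w * (z * z)"
      unfolding k1 k2 k3 by (simp add: algebra_simps)
    also have "\<dots> = N * (k1 + t * k3 * fst w * k5 - k2 - t * snd x * k2 * z -
        t * t * snd x * snd y * fst w * k4)"
      unfolding k4 k5 by (simp add: algebra_simps)
    finally have "N dvd (?u mod N + fst w + t * ((snd x + snd y) mod L) * fst w * z) -
        (fst x + ?v mod N + t * snd x * (?v mod N) * z)" by simp
    then have "(?u mod N + fst w + t * ((snd x + snd y) mod L) * fst w * z) mod N =
        (fst x + ?v mod N + t * snd x * (?v mod N) * z) mod N"
      by (simp add: mod_eq_dvd_iff)
    then show ?thesis by (simp add: mult_T mod_simps add.assoc)
  qed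
  show "\<exists>y\<in>carrier (T t). y \<otimes>\<^bsub>T t\<^esub> x = \<one>\<^bsub>T t\<^esub>" for x
  proof -
    let ?b = "(- snd x) mod L"
    let ?y = "((- (fst x + t * ?b * fst x * z)) mod N, ?b)"
    have "(- (fst x + t * ?b * fst x * z)) mod N + fst x + t * ?b * fst x * z =
      (- (fst x + t * ?b * fst x * z)) mod N + (fst x + t * ?b * fst x * z)" by simp
    then have "?y \<otimes>\<^bsub>T t\<^esub> x = \<one>\<^bsub>T t\<^esub>"
      by (simp only: mult_T one_T fst_conv snd_conv) (simp add: mod_simps)
    moreover have "?y \<in> carrier (T t)" using N_gt_1 L_gt_1 by (simp add: carrier_T)
    ultimately show ?thesis by blast
  qed
qed

lemma finite_T: "finite (carrier (T t))"
  by (simp add: carrier_T)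

lemma order_T: "order (T t) = p ^ (m + n)"
  by (simp add: order_def carrier_T card_cartesian_product N_def L_def nat_power_eq power_add)

text \<open>For \<open>x = (a, b)\<close>, multiplying \<open>x^i\<close> by \<open>x\<close> adds
  the twist \<open>t * i * a * b * z\<close>; the sum of all \<open>i < k\<close> is
  \<open>k choose 2\<close>.\<close>

lemma pow_T:
  "x [^]\<^bsub>T t\<^esub> k = ((int k * fst x + t * int (k choose 2) * fst x * snd x * z) mod N,
    (int k * snd x) mod L)"
proof (induction k)
  case 0
  then show ?case by (simp add: one_T numeral_2_eq_2)
next
  case (Suc k)
  obtain l where l: "(int k * snd x) mod L = int k * snd x + L * l" using mod_int_ex by blast
  obtain k5 where k5: "L * z = N * k5" using N_dvd_Lz by blast
  have ch: "int (Suc k choose 2) = int (k choose 2) + int k"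
    by (simp add: numeral_2_eq_2)
  let ?u = "int k * fst x + t * int (k choose 2) * fst x * snd x * z"
  have "(?u mod N + fst x + t * ((int k * snd x) mod L) * fst x * z) mod N =
      (?u + fst x + t * (int k * snd x + L * l) * fst x * z) mod N"
    unfolding l by (simp only: add.assoc mod_add_left_eq)
  also have "?u + fst x + t * (int k * snd x + L * l) * fst x * z =
      (int (Suc k) * fst x + t * int (Suc k choose 2) * fst x * snd x * z) + t * l * fst x * (L * z)"
    unfolding ch by (simp add: algebra_simps)
  also have "\<dots> mod N = (int (Suc k) * fst x + t * int (Suc k choose 2) * fst x * snd x * z) mod N"
    unfolding k5 by (metis mod_mult_self2 mult.left_commute)
  finally show ?case by (simp add: Suc mult_T mod_simps algebra_simps)
qed

text \<open>If some \<open>(a, b) \<in> H\<close> has \<open>a\<close> prime to \<open>p\<close>, then a suitable multiple of \<open>p\<^bsup>m - 1\<^esup>\<close> is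
  an exponent taking it to \<open>(p\<^bsup>m - 1\<^esup>, 0)\<close>. This is where \<open>n < m\<close>, and \<open>3 \<le> m\<close> for \<open>p = 2\<close>,
  are needed.\<close>

lemma subgroup_T_cases:
  assumes H: "subgroup H (T t)"
  shows "(z, 0) \<in> H \<or> (\<forall>x\<in>H. int p dvd fst x)"
proof (rule disjCI)
  interpret T: group "T t" by (rule group_T)
  assume "\<not> (\<forall>x\<in>H. int p dvd fst x)"
  then obtain x where x: "x \<in> H" "\<not> int p dvd fst x" by blast
  have "coprime (fst x) (int p)"
    using x p by (metis coprime_commute prime_imp_coprime prime_nat_int_transfer)
  then obtain u v where uv: "u * fst x + v * int p = 1"
    by (metis bezout_int coprime_iff_gcd_eq_1)
  \<comment> \<open>\<open>u\<close> inverts \<open>fst x\<close> modulo \<open>p\<close> and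
    \<open>k\<close> is its non-negative representative, so \<open>z * k * fst x\<close> is
    \<open>z\<close> modulo \<open>N = z * p\<close>; the binomial term is a multiple of
    \<open>p * z\<close> and drops out.\<close>
  define k where "k = nat (u mod int p)"
  have "int k = u mod int p" using p_gt_1 by (simp add: k_def)
  moreover obtain l where "u mod int p = u + int p * l" using mod_int_ex by blast
  ultimately have k: "int k = u + int p * l" by simp
  obtain c where "((p ^ (m - 1) * k) choose 2) = p * c"
    using prime_dvd_choose_two[OF p _ two, of k] n nm by auto
  then have c: "int ((p ^ (m - 1) * k) choose 2) = int p * int c" by simp
  have "z * int k * fst x + t * int ((p ^ (m - 1) * k) choose 2) * fst x * snd x * z =
      z * (u * fst x + v * int p) + N * (l * fst x - v + t * int c * fst x * snd x)"
    unfolding c k N_eq by (simp add: algebra_simps)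
  also have "\<dots> mod N = z mod N" unfolding uv by simp
  also have "\<dots> = z" using z_gt_1 p_gt_1 by (simp add: N_eq)
  finally have "x [^]\<^bsub>T t\<^esub> (p ^ (m - 1) * k) = (z, 0)"
    using L_dvd_z by (simp add: pow_T z_def)
  then show "(z, 0) \<in> H"
    using T.subgroup_nat_pow_closed[OF H x(1)] by metis
qed

lemma subgroup_T_imp:
  assumes H: "subgroup H (T t)"
  shows "subgroup H (T t')"
proof -
  interpret H: subgroup H "T t" by (rule H)
  interpret T: group "T t" by (rule group_T)
  interpret T': group "T t'" by (rule group_T)
  have HT': "H \<subseteq> carrier (T t')" using H.subset by (simp add: carrier_T)
  show ?thesis
  proof (rule T'.subgroup_if_finite_mult_closed)
    show "finite H" using finite_T HT' by (rule rev_finite_subset)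
    show "H \<noteq> {}" using H.one_closed by blast
    fix x y assume xy: "x \<in> H" "y \<in> H"
    show "x \<otimes>\<^bsub>T t'\<^esub> y \<in> H"
    proof (cases "\<forall>x\<in>H. int p dvd fst x")
      case True
      \<comment> \<open>With \<open>p\<close> dividing \<open>fst y\<close>, the twist is a multiple
        of \<open>z * p = N\<close> for every parameter, so the two products coincide.\<close>
      then obtain a where a: "fst y = int p * a" using xy by blast
      have *: "s * snd x * fst y * z = N * (s * snd x * a)" for s
        by (simp add: a N_eq)
      have "x \<otimes>\<^bsub>T t'\<^esub> y = x \<otimes>\<^bsub>T t\<^esub> y" unfolding mult_T * by simp
      then show ?thesis using xy by simp
    next
      case False
      then have "(z, 0) \<in> H" using subgroup_T_cases[OF H] by blast
      \<comment> \<open>The products differ by \<open>(t' - t) * snd x * fst y * z\<close> in the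
        first coordinate, and \<open>k\<close> represents this coefficient of \<open>z\<close>.
        Multiplying by the \<open>k\<close>-th power of \<open>(z, 0)\<close> makes up the
        difference; its own twist is a multiple of \<open>z * z\<close> modulo \<open>N\<close> and
        vanishes.\<close>
      define k where "k = nat (((t' - t) * snd x * fst y) mod N)"
      have "int k = ((t' - t) * snd x * fst y) mod N" using N_gt_1 by (simp add: k_def)
      then obtain l where k: "int k = (t' - t) * snd x * fst y + N * l" using mod_int_ex by metis
      obtain k4 where k4: "z * z = N * k4" using N_dvd_zz by blast
      have w: "(z, 0) [^]\<^bsub>T t\<^esub> k = (int k * z mod N, 0)" by (simp add: pow_T)
      have "(x \<otimes>\<^bsub>T t\<^esub> y) \<otimes>\<^bsub>T t\<^esub> (z, 0) [^]\<^bsub>T t\<^esub> k \<in> H"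
        using xy \<open>(z, 0) \<in> H\<close> T.subgroup_nat_pow_closed[OF H] by blast
      moreover have "(x \<otimes>\<^bsub>T t\<^esub> y) \<otimes>\<^bsub>T t\<^esub> (z, 0) [^]\<^bsub>T t\<^esub> k = x \<otimes>\<^bsub>T t'\<^esub> y"
      proof -
        let ?b = "(snd x + snd y) mod L"
        obtain j where j: "int k * z mod N = int k * z + N * j" using mod_int_ex by blast
        let ?u = "fst x + fst y + t * snd x * fst y * z"
        have "(?u mod N + (int k * z mod N) + t * ?b * (int k * z mod N) * z) mod N =
            (?u + (int k * z + N * j) + t * ?b * (int k * z + N * j) * z) mod N"
          unfolding j by (simp only: add.assoc mod_add_left_eq)
        also have "?u + (int k * z + N * j) + t * ?b * (int k * z + N * j) * z =
            (fst x + fst y + t' * snd x * fst y * z) +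
              N * (l * z + j + t * ?b * j * z) + t * ?b * int k * (z * z)"
          by (simp add: k algebra_simps)
        also have "\<dots> = (fst x + fst y + t' * snd x * fst y * z) +
              N * (l * z + j + t * ?b * j * z + t * ?b * int k * k4)"
          unfolding k4 by (simp add: algebra_simps)
        finally show ?thesis by (simp add: w mult_T)
      qed
      ultimately show ?thesis by simp
    qed
  qed (rule HT')
qed

lemma subgroup_T_iff: "subgroup H (T t) \<longleftrightarrow> subgroup H (T t')"
  using subgroup_T_imp by blast

section \<open>The twisted products as the abelian group and as \<open>Gp\<close>\<close>

lemma T_0: "T 0 = integer_mod_group (p ^ m) \<times>\<times> integer_mod_group (p ^ n)"
  using p prime_gt_0_nat[OF p]
  by (auto simp: T_def DirProd_def carrier_integer_mod_group N_def L_def split_beta fun_eq_iff)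

lemma metacyclic_T: "metacyclic (T 1) (1, 0) (0, 1) (p ^ m) (p ^ n) 0 (1 + p ^ (m - 1))"
proof -
  interpret T: group "T 1" by (rule group_T)
  have d: "int (1 + p ^ (m - 1)) = 1 + z" by (simp add: z_def)
  show ?thesis
  proof
    show "(0, 1) \<otimes>\<^bsub>T 1\<^esub> (1, 0) = (1, 0) [^]\<^bsub>T 1\<^esub> (1 + p ^ (m - 1)) \<otimes>\<^bsub>T 1\<^esub> (0, 1)"
      unfolding pow_T d by (simp add: mult_T)
    fix K assume K: "subgroup K (T 1)" "(1, 0) \<in> K" "(0, 1) \<in> K"
    show "carrier (T 1) \<subseteq> K"
    proof
      fix w assume w: "w \<in> carrier (T 1)"
      \<comment> \<open>Powers of sigma followed by powers of tau create no twist: the left factor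
        has second coordinate 0.\<close>
      have "(1, 0) [^]\<^bsub>T 1\<^esub> nat (fst w) \<otimes>\<^bsub>T 1\<^esub> (0, 1) [^]\<^bsub>T 1\<^esub> nat (snd w) \<in> K"
        using K T.subgroup_nat_pow_closed subgroup.m_closed by metis
      moreover have "(1, 0) [^]\<^bsub>T 1\<^esub> nat (fst w) \<otimes>\<^bsub>T 1\<^esub> (0, 1) [^]\<^bsub>T 1\<^esub> nat (snd w) = w"
        using w by (cases w) (auto simp: carrier_T pow_T mult_T)
      ultimately show "w \<in> K" by simp
    qed
  qed (use N_gt_1 L_gt_1 p_gt_1 in \<open>auto simp: carrier_T pow_T one_T N_def L_def prime_gt_0_nat[OF p]\<close>)
qed

lemma Gp_iso_T: "Gp p m n \<cong> T 1"
  using metacyclic.presented_group_iso_metacyclic[OF metacyclic_T] order_T[of 1]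
  by (simp add: Gp_def Gp_relations_metacyclic power_add)

lemma group_Gp: "group (Gp p m n)"
  by (simp add: Gp_def group_presented_group)

lemma finite_Gp: "finite (carrier (Gp p m n))"
  using iso_finite[OF Gp_iso_T] finite_T by blast

lemma order_Gp: "order (Gp p m n) = p ^ (m + n)"
  using iso_same_card[OF Gp_iso_T] order_T[of 1] by (simp add: order_def)

lemma not_comm_Gp: "\<not> comm_group (Gp p m n)"
proof
  assume "comm_group (Gp p m n)"
  then interpret T: comm_group "T 1"
    using comm_group.iso_imp_comm_group[OF _ Gp_iso_T] group_T group.is_monoid by blast
  have "(1, 0) \<otimes>\<^bsub>T 1\<^esub> (0, 1) = (0, 1) \<otimes>\<^bsub>T 1\<^esub> (1, 0)"
    using N_gt_1 L_gt_1 by (intro T.m_comm) (auto simp: carrier_T)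
  then have "1 mod N = (1 + z) mod N" by (simp add: mult_T)
  then have "N dvd z" by (simp add: mod_eq_dvd_iff)
  then show False using z_gt_1 p_gt_1 zdvd_not_zless[of z N] by (simp add: N_eq)
qed

lemma group_zeta_Gp: "group_zeta (Gp p m n) = group_zeta (integer_mod_group (p ^ m) \<times>\<times> integer_mod_group (p ^ n))"
proof -
  have "group_zeta (Gp p m n) = group_zeta (T 1)"
    by (rule group_zeta_iso[OF group_Gp group_T Gp_iso_T finite_T])
  also have "\<dots> = group_zeta (T 0)"
    by (rule ext) (simp add: group_zeta_def num_subgroups_def subgroup_T_iff[of _ 1 0])
  finally show ?thesis by (simp add: T_0)
qed

lemma group_zeta_Gp_symmetry:
  "group_zeta (Gp p m n) s = of_nat (order (Gp p m n)) powr (- s) * group_zeta (Gp p m n) (- s)"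
proof -
  interpret cyclic_pair "p ^ m" "p ^ n" "p ^ (m - n)"
    using prime_gt_0_nat[OF p] nm by unfold_locales (auto simp: power_add[symmetric])
  show ?thesis
    using group_zeta_symmetry[of s] unfolding group_zeta_Gp order_Gp A_def power_add by simp
qed

end

section \<open>Groups of order \<open>p\<^sup>2\<close> and \<open>8\<close>\<close>

locale finite_group = group G for G (structure) +
  assumes finite_carrier [simp]: "finite (carrier G)"
begin

lemma card_subgroup_dvd: "subgroup K G \<Longrightarrow> card K dvd order G"
  using lagrange by (metis dvd_triv_right)

lemma finite_subgroup: "subgroup K G \<Longrightarrow> finite K"
  using finite_carrier finite_subset subgroup.subset by blast

lemma ord_pos: "x \<in> carrier G \<Longrightarrow> 0 < ord x"
  using ord_ge_1[OF finite_carrier, of x] by simp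

lemma generate_eq_powers:
  assumes "x \<in> carrier G"
  shows "generate G {x} = (\<lambda>i. x [^] i) ` {..<ord x}"
proof -
  have "x [^] k \<in> (\<lambda>i. x [^] i) ` {..<ord x}" for k :: nat
  proof -
    have "x [^] k = x [^] (ord x * (k div ord x)) \<otimes> x [^] (k mod ord x)"
      using assms by (simp add: nat_pow_mult)
    also have "x [^] (ord x * (k div ord x)) = \<one>"
      using assms pow_eq_id[of x "ord x * (k div ord x)"] by simp
    finally have "x [^] k = x [^] (k mod ord x)" using assms by simp
    then show ?thesis using ord_pos[OF assms] by (metis imageI lessThan_iff mod_less_divisor)
  qed
  then show ?thesis
    unfolding generate_pow_on_finite_carrier[OF finite_carrier assms] by auto
qed

lemma subgroup_generate: "x \<in> carrier G \<Longrightarrow> subgroup (generate G {x}) G"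
  by (rule generate_is_subgroup) simp

lemma mem_generate: "x \<in> generate G {x}"
  by (rule generate.incl) simp

lemma generate_subset: "subgroup K G \<Longrightarrow> x \<in> K \<Longrightarrow> generate G {x} \<subseteq> K"
  by (rule generate_subgroup_incl) simp_all

lemma ex_notin_if_card_lt:
  assumes "finite S" "card S < order G"
  shows "\<exists>x\<in>carrier G. x \<notin> S"
  using card_mono[OF assms(1), of "carrier G"] assms(2) by (auto simp: order_def)

lemma ord_prime_power:
  assumes "prime p" "order G = p ^ k" "x \<in> carrier G"
  obtains i where "i \<le> k" "ord x = p ^ i"
  using ord_dvd_group_order[OF \<open>x \<in> carrier G\<close>] divides_primepow_nat[OF \<open>prime p\<close>] assms by auto

lemma carrier_subset_if_card_gt:
  assumes p: "prime p" and order: "order G = p ^ Suc k"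
    and K: "subgroup K G" and card: "p ^ k < card K"
  shows "carrier G \<subseteq> K"
proof -
  have "card K dvd p ^ Suc k" using card_subgroup_dvd[OF K] order by simp
  then obtain i where i: "i \<le> Suc k" "card K = p ^ i"
    unfolding divides_primepow_nat[OF p] by blast
  then have "k < i" using card prime_gt_1_nat[OF p] by (simp add: power_strict_increasing_iff)
  then have "i = Suc k" using i by simp
  then have "card K = order G" using i order by simp
  then show ?thesis
    using card_subset_eq[OF finite_carrier subgroup.subset[OF K]] by (simp add: order_def)
qed

text \<open>The powers of \<open>x\<close> form a subgroup of index \<open>p\<close>; a subgroup
  containing also \<open>y\<close> has more than \<open>p ^ k\<close> elements and, its order
  dividing \<open>p ^ Suc k\<close>, is everything.\<close>

lemma metacyclicI:
  assumes p: "prime p" and order: "order G = p ^ Suc k" and x: "x \<in> carrier G" and y: "y \<in> carrier G"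
    and ord: "ord x = p ^ k" and notin: "y \<notin> generate G {x}"
    and rel: "y [^] p = x [^] c" "y \<otimes> x = x [^] d \<otimes> y"
  shows "metacyclic G x y (p ^ k) p c d"
proof
  show "x [^] (p ^ k) = \<one>" using x ord pow_ord_eq_1 by metis
  fix K assume K: "subgroup K G" "x \<in> K" "y \<in> K"
  then have "generate G {x} \<subset> K" using notin generate_subset by blast
  then have "p ^ k < card K"
    using psubset_card_mono[OF finite_subgroup[OF K(1)]] generate_pow_card[OF x] ord by simp
  then show "carrier G \<subseteq> K" by (rule carrier_subset_if_card_gt[OF p order K(1)])
qed (use assms prime_gt_0_nat[OF p] in auto)

section \<open>Cyclic groups and their subgroups\<close>

lemma generate_eq_carrier_if_cyclic:
  assumes x: "x \<in> carrier G" and ord: "ord x = order G"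
  shows "generate G {x} = carrier G"
  using card_subset_eq[OF finite_carrier subgroup.subset[OF subgroup_generate[OF x]]]
    generate_pow_card[OF x] ord by (simp add: order_def)

text \<open>Taking \<open>y = \<one>\<close> and \<open>b = 1\<close> places cyclic groups, the
  trivial one included, in the metacyclic family.\<close>

lemma metacyclic_if_cyclic:
  assumes x: "x \<in> carrier G" and ord: "ord x = order G"
  shows "metacyclic G x \<one> (order G) 1 0 1"
proof
  show "0 < order G" using ord_pos[OF x] ord by simp
  show "x [^] order G = \<one>" using x by (rule pow_order_eq_1)
  fix K assume K: "subgroup K G" "x \<in> K"
  then show "carrier G \<subseteq> K"
    using generate_subset generate_eq_carrier_if_cyclic[OF x ord] by metis
qed (use x in auto)

text \<open>Lagrange gives one inclusion. With \<open>order G = card K * q\<close>, the roots are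
  among the \<open>card K\<close> powers of \<open>x^q\<close>, so the sizes agree. As the right
  side depends on \<open>K\<close> only through its order, each order occurs at most once.\<close>

lemma subgroup_eq_roots_if_cyclic:
  assumes x: "x \<in> carrier G" and ord: "ord x = order G" and K: "subgroup K G"
  shows "K = {g \<in> carrier G. g [^] card K = \<one>}"
proof (rule card_subset_eq)
  interpret K: subgroup K G by fact
  interpret KG: group "G\<lparr>carrier := K\<rparr>" by (rule subgroup_imp_group[OF K])
  let ?R = "{g \<in> carrier G. g [^] card K = \<one>}"
  show "finite ?R" by simp
  show sub: "K \<subseteq> ?R"
  proof
    fix g assume g: "g \<in> K"
    then have "g [^]\<^bsub>G\<lparr>carrier := K\<rparr>\<^esub> order (G\<lparr>carrier := K\<rparr>) = \<one>\<^bsub>G\<lparr>carrier := K\<rparr>\<^esub>"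
      by (intro KG.pow_order_eq_1) simp
    then show "g \<in> ?R" using g K.subset by (auto simp: order_def nat_pow_consistent[symmetric])
  qed
  obtain q where q: "order G = card K * q" using card_subgroup_dvd[OF K] by blast
  have "0 < order G" using ord_pos[OF x] ord by simp
  then have pos: "0 < card K" "0 < q" using q by auto
  have carr: "carrier G = (\<lambda>i. x [^] i) ` {..<order G}"
    using generate_eq_powers[OF x] generate_eq_carrier_if_cyclic[OF x ord] ord by simp
  have "?R \<subseteq> (\<lambda>j. x [^] (q * j)) ` {..<card K}"
  proof
    fix g assume g: "g \<in> ?R"
    then obtain i where i: "i < order G" "g = x [^] i" using carr by blast
    then have "x [^] (i * card K) = \<one>" using g x by (simp add: nat_pow_pow)
    then have "card K * q dvd i * card K" using pow_eq_id[OF x] ord q by simp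
    then obtain j where j: "i = q * j" using pos by (auto simp: mult.commute)
    then have "j < card K" using i q pos by (simp add: mult.commute)
    then show "g \<in> (\<lambda>j. x [^] (q * j)) ` {..<card K}" using i j by blast
  qed
  then have "card ?R \<le> card {..<card K}" by (rule surj_card_le[rotated]) simp
  moreover have "card K \<le> card ?R" by (rule card_mono[OF _ sub]) simp
  ultimately show "card K = card ?R" by simp
qed

lemma num_subgroups_le_1_if_cyclic:
  assumes x: "x \<in> carrier G" and ord: "ord x = order G"
  shows "num_subgroups k G \<le> 1"
proof -
  have "{K. subgroup K G \<and> card K = k} \<subseteq> {{g \<in> carrier G. g [^] k = \<one>}}"
    using subgroup_eq_roots_if_cyclic[OF x ord] by auto
  then have "card {K. subgroup K G \<and> card K = k} \<le> card {{g \<in> carrier G. g [^] k = \<one>}}"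
    by (intro card_mono) auto
  then show ?thesis by (simp add: num_subgroups_def)
qed

lemma two_le_num_subgroups:
  assumes "subgroup H G" "subgroup K G" "card H = k" "card K = k" "H \<noteq> K"
  shows "2 \<le> num_subgroups k G"
proof -
  have "{H, K} \<subseteq> {H. subgroup H G \<and> card H = k}" using assms by simp
  moreover have "finite {H. subgroup H G \<and> card H = k}"
    using finite_subgroups[OF finite_carrier] by (rule rev_finite_subset) auto
  ultimately have "card {H, K} \<le> num_subgroups k G" unfolding num_subgroups_def by (intro card_mono)
  then show ?thesis using assms by simp
qed

text \<open>The double coset map \<open>(h, k) \<mapsto> h g k\<close> on \<open>H \<times> H\<close> would be a bijection onto \<open>G\<close> if \<open>H\<close> met its
  conjugate by \<open>g\<close> trivially; but then \<open>1 = h g k\<close>, so \<open>g\<close> would lie in \<open>H\<close>.\<close>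

lemma conj_closed_order_prime_square:
  assumes p: "prime p" and order: "order G = p\<^sup>2" and H: "subgroup H G" and card: "card H = p"
    and g: "g \<in> carrier G" and h: "h \<in> H"
  shows "inv g \<otimes> h \<otimes> g \<in> H"
proof -
  interpret H: subgroup H G by fact
  \<comment> \<open>\<open>S\<close> is the intersection of \<open>H\<close> with its conjugate
    \<open>g H g^-1\<close>; its order is a power of \<open>p\<close>, so it is trivial or all of
    \<open>H\<close>.\<close>
  define S where "S = {h \<in> H. inv g \<otimes> h \<otimes> g \<in> H}"
  have conj: "inv g \<otimes> (a \<otimes> b) \<otimes> g = (inv g \<otimes> a \<otimes> g) \<otimes> (inv g \<otimes> b \<otimes> g)"
    if "a \<in> H" "b \<in> H" for a b
  proof -
    have "(inv g \<otimes> a \<otimes> g) \<otimes> (inv g \<otimes> b \<otimes> g) = inv g \<otimes> a \<otimes> (g \<otimes> inv g) \<otimes> b \<otimes> g"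
      using that g by (simp only: m_assoc H.mem_carrier m_closed inv_closed)
    then show ?thesis using that g by (simp add: m_assoc)
  qed
  have S: "subgroup S G"
  proof (rule subgroup_if_finite_mult_closed)
    show "finite S" using finite_subgroup[OF H] by (simp add: S_def)
    have "\<one> \<in> S" using g by (simp add: S_def)
    then show "S \<noteq> {}" by blast
  qed (auto simp: S_def conj)
  have "card S dvd p ^ 2" using card_subgroup_dvd[OF S] order by simp
  then obtain i where i: "card S = p ^ i" unfolding divides_primepow_nat[OF p] by blast
  have "S = H"
  proof (cases "i = 0")
    case True
    then have "S = {\<one>}"
      using i subgroup.one_closed[OF S] by (metis card_1_singletonE power_0 singletonD)
    have "inj_on (\<lambda>(a, b). a \<otimes> g \<otimes> b) (H \<times> H)"
    proof (rule inj_onI, clarify)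
      fix a b a' b' assume ab: "a \<in> H" "b \<in> H" "a' \<in> H" "b' \<in> H" and eq: "a \<otimes> g \<otimes> b = a' \<otimes> g \<otimes> b'"
      have "inv a' \<otimes> (a \<otimes> g \<otimes> b) \<otimes> inv b = inv a' \<otimes> a \<otimes> g"
        using ab g by (simp add: m_assoc)
      moreover have "inv a' \<otimes> (a' \<otimes> g \<otimes> b') \<otimes> inv b = g \<otimes> (b' \<otimes> inv b)"
        using ab g by (simp add: m_assoc[symmetric])
      ultimately have "inv a' \<otimes> a \<otimes> g = g \<otimes> (b' \<otimes> inv b)" by (simp add: eq)
      then have "inv g \<otimes> (inv a' \<otimes> a) \<otimes> g = b' \<otimes> inv b"
        using ab g by (metis H.mem_carrier inv_solve_left m_assoc m_closed inv_closed)
      then have "inv a' \<otimes> a \<in> S" using ab by (simp add: S_def)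
      then have 1: "inv a' \<otimes> a = \<one>" using \<open>S = {\<one>}\<close> by simp
      then have "a = a'" using ab by (metis H.mem_carrier inv_closed inv_equality inv_inv)
      moreover from this have "b = b'" using eq ab g by simp
      ultimately show "a = a' \<and> b = b'" by simp
    qed
    then have "card ((\<lambda>(a, b). a \<otimes> g \<otimes> b) ` (H \<times> H)) = p * p"
      using card by (simp add: card_image card_cartesian_product)
    moreover have "(\<lambda>(a, b). a \<otimes> g \<otimes> b) ` (H \<times> H) \<subseteq> carrier G" using g by auto
    ultimately have "(\<lambda>(a, b). a \<otimes> g \<otimes> b) ` (H \<times> H) = carrier G"
      using order by (intro card_subset_eq) (auto simp: order_def power2_eq_square)
    then have "\<one> \<in> (\<lambda>(a, b). a \<otimes> g \<otimes> b) ` (H \<times> H)" by simp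
    then obtain a b where ab: "a \<in> H" "b \<in> H" "a \<otimes> g \<otimes> b = \<one>" by auto
    then have "a \<otimes> g = inv b" using g by (metis H.mem_carrier inv_equality m_closed)
    then have "g = inv a \<otimes> inv b" using ab g by (metis H.mem_carrier inv_closed inv_solve_left)
    then have "g \<in> H" using ab by simp
    then show ?thesis by (auto simp: S_def)
  next
    case False
    then have "p \<le> card S" using i prime_gt_0_nat[OF p] by (cases i) auto
    moreover have "S \<subseteq> H" by (auto simp: S_def)
    ultimately show ?thesis using card card_seteq[OF finite_subgroup[OF H]] by blast
  qed
  then show ?thesis using h by (auto simp: S_def)
qed

text \<open>Two distinct subgroups of order \<open>p\<close> meet trivially and are both stable
  under conjugation, so the commutator of their generators lies in the intersection and is
  trivial.\<close>

lemma order_prime_square_noncyclic: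
  assumes p: "prime p" and order: "order G = p\<^sup>2" and nc: "\<And>x. x \<in> carrier G \<Longrightarrow> ord x \<noteq> order G"
  obtains x y where "metacyclic G x y p p 0 1" "2 \<le> num_subgroups p G"
proof -
  have ord: "ord x = p" if x: "x \<in> carrier G" "x \<noteq> \<one>" for x
  proof -
    obtain i where i: "i \<le> 2" "ord x = p ^ i" using ord_prime_power[OF p order x(1)] .
    moreover have "i \<noteq> 0" using i x ord_eq_1[OF x(1)] by (intro notI) simp
    moreover have "i \<noteq> 2" using i nc[OF x(1)] order by auto
    ultimately have "i = 1" by simp
    then show ?thesis using i by simp
  qed
  have p1: "1 < p" using prime_gt_1_nat[OF p] .
  then have "p < order G" by (simp add: order power2_eq_square)
  with p1 have lt: "1 < order G" "p < order G" by simp_all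
  obtain x where x: "x \<in> carrier G" "x \<noteq> \<one>" using ex_notin_if_card_lt[of "{\<one>}"] lt by auto
  let ?H = "generate G {x}"
  have H: "subgroup ?H G" "card ?H = p"
    using subgroup_generate[OF x(1)] generate_pow_card[OF x(1)] ord[OF x] by auto
  obtain y where y: "y \<in> carrier G" "y \<notin> ?H"
    using ex_notin_if_card_lt[OF finite_subgroup[OF H(1)]] H lt by auto
  have "y \<noteq> \<one>" using y subgroup.one_closed[OF H(1)] by blast
  let ?K = "generate G {y}"
  have K: "subgroup ?K G" "card ?K = p"
    using subgroup_generate[OF y(1)] generate_pow_card[OF y(1)] ord[OF y(1) \<open>y \<noteq> \<one>\<close>] by auto
  have "?H \<noteq> ?K" using y mem_generate by blast
  have HK: "subgroup (?H \<inter> ?K) G" using H K by (simp add: subgroups_Inter_pair)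
  obtain i where i: "card (?H \<inter> ?K) = p ^ i"
    using card_subgroup_dvd[OF HK] divides_primepow_nat[OF p] order by auto
  have "card (?H \<inter> ?K) < p"
    using \<open>?H \<noteq> ?K\<close> H K finite_subgroup psubset_card_mono[of ?H "?H \<inter> ?K"]
    by (metis Int_lower1 Int_lower2 card_subset_eq psubsetI)
  then have "i = 0" using i p1 by (cases i) auto
  then have triv: "?H \<inter> ?K = {\<one>}"
    using i subgroup.one_closed[OF HK] by (metis card_1_singletonE power_0 singletonD)
  \<comment> \<open>Bracketed one way the commutator lies in \<open>?H\<close>, bracketed the other
    way in \<open>?K\<close>.\<close>
  define c where "c = inv y \<otimes> x \<otimes> y \<otimes> inv x"
  have "inv y \<otimes> x \<otimes> y \<in> ?H"
    using conj_closed_order_prime_square[OF p order H y(1) mem_generate] .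
  then have "c \<in> ?H" unfolding c_def using H mem_generate
    by (simp add: subgroup.m_closed subgroup.m_inv_closed)
  moreover have "x \<otimes> y \<otimes> inv x \<in> ?K"
    using conj_closed_order_prime_square[OF p order K inv_closed[OF x(1)] mem_generate] x(1) by simp
  then have "inv y \<otimes> (x \<otimes> y \<otimes> inv x) \<in> ?K" using K mem_generate
    by (simp add: subgroup.m_closed subgroup.m_inv_closed)
  then have "c \<in> ?K" unfolding c_def using x y by (simp add: m_assoc)
  ultimately have "c = \<one>" using triv by blast
  then have "x \<otimes> y = y \<otimes> x"
    unfolding c_def using x y by (metis inv_closed inv_equality inv_inv inv_solve_left m_assoc m_closed)
  then have "metacyclic G x y (p ^ 1) p 0 1"
    using x y order p H K generate_pow_card ord \<open>y \<noteq> \<one>\<close> pow_ord_eq_1[of y]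
    by (intro metacyclicI) (auto simp: numeral_2_eq_2)
  moreover have "2 \<le> num_subgroups p G" using H K \<open>?H \<noteq> ?K\<close> by (intro two_le_num_subgroups)
  ultimately show ?thesis using that by simp
qed

text \<open>An involution \<open>g\<close> corresponds to the subgroup \<open>{\<one>, g}\<close>;
  the \<open>+ 1\<close> accounts for \<open>\<one>\<close> itself.\<close>

lemma num_subgroups_2: "num_subgroups 2 G + 1 = card {g \<in> carrier G. g \<otimes> g = \<one>}"
proof -
  let ?I = "{g \<in> carrier G. g \<otimes> g = \<one>}"
  have "bij_betw (\<lambda>g. {\<one>, g}) (?I - {\<one>}) {H. subgroup H G \<and> card H = 2}"
    unfolding bij_betw_def
  proof
    show "inj_on (\<lambda>g. {\<one>, g}) (?I - {\<one>})" by (auto simp: inj_on_def doubleton_eq_iff)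
    show "(\<lambda>g. {\<one>, g}) ` (?I - {\<one>}) = {H. subgroup H G \<and> card H = 2}"
    proof (intro equalityI subsetI)
      fix H assume "H \<in> (\<lambda>g. {\<one>, g}) ` (?I - {\<one>})"
      then obtain g where g: "g \<in> carrier G" "g \<otimes> g = \<one>" "g \<noteq> \<one>" "H = {\<one>, g}" by blast
      then have "subgroup H G" by (intro subgroup_if_finite_mult_closed) auto
      then show "H \<in> {H. subgroup H G \<and> card H = 2}" using g by simp
    next
      fix H assume "H \<in> {H. subgroup H G \<and> card H = 2}"
      then have H: "subgroup H G" "card H = 2" by auto
      then have "\<one> \<in> H" by (simp add: subgroup.one_closed)
      then obtain g where g: "H = {\<one>, g}" "g \<noteq> \<one>"
        using H(2) by (metis card_2_iff doubleton_eq_iff insertE singletonD)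
      have gc: "g \<in> carrier G" using g subgroup.subset[OF H(1)] by blast
      have "g \<otimes> g \<in> H" using g(1) by (intro subgroup.m_closed[OF H(1)]) simp_all
      then have "g \<otimes> g = \<one>" using g gc by auto
      then show "H \<in> (\<lambda>g. {\<one>, g}) ` (?I - {\<one>})" using g gc by blast
    qed
  qed
  then have "num_subgroups 2 G = card (?I - {\<one>})"
    unfolding num_subgroups_def by (rule bij_betw_same_card[symmetric])
  moreover have "card ?I = Suc (card (?I - {\<one>}))" by (rule card.remove) auto
  ultimately show ?thesis by (simp only: Suc_eq_plus1)
qed

text \<open>The complement of \<open>H\<close> is the single coset of \<open>H\<close> through
  \<open>g\<close>. It contains \<open>inv h\<close>, and \<open>inv h = k \<otimes> g\<close> with
  \<open>k \<in> H\<close> means \<open>g \<otimes> h = inv k\<close>.\<close>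

lemma mult_mem_if_index_2:
  assumes H: "subgroup H G" and card: "order G = 2 * card H"
    and g: "g \<in> carrier G" "g \<notin> H" and h: "h \<in> carrier G" "h \<notin> H"
  shows "g \<otimes> h \<in> H"
proof -
  interpret H: subgroup H G by fact
  have "inj_on (\<lambda>k. k \<otimes> g) H" using g by (auto intro: inj_onI)
  then have "card ((\<lambda>k. k \<otimes> g) ` H) = card H" by (rule card_image)
  moreover have "(\<lambda>k. k \<otimes> g) ` H \<subseteq> carrier G - H"
  proof safe
    fix k assume k: "k \<in> H" "k \<otimes> g \<in> H"
    then have "inv k \<otimes> (k \<otimes> g) \<in> H" by blast
    then show False using k g by (simp add: m_assoc[symmetric])
  qed (use g in auto)
  moreover have "card (carrier G - H) = card H"
    using card H.subset finite_subgroup[OF H] by (simp add: card_Diff_subset order_def)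
  ultimately have "(\<lambda>k. k \<otimes> g) ` H = carrier G - H" by (intro card_subset_eq) auto
  moreover have "inv h \<in> carrier G - H" using h H.m_inv_closed[of "inv h"] by auto
  ultimately obtain k where k: "k \<in> H" "inv h = k \<otimes> g" by blast
  have "k \<otimes> (g \<otimes> h) = inv h \<otimes> h" unfolding k(2) using k(1) g h by (simp add: m_assoc)
  then have "k \<otimes> (g \<otimes> h) = \<one>" using h by simp
  then have "inv (g \<otimes> h) = k" using k g h by (intro inv_equality) auto
  then have "inv (inv (g \<otimes> h)) \<in> H" using k(1) by blast
  then show ?thesis using g h by simp
qed

end

lemma (in metacyclic) x_pow_eq_one_iff:
  assumes "order G = a * b"
  shows "x [^] (k :: nat) = \<one> \<longleftrightarrow> a dvd k"
proof
  assume "x [^] k = \<one>"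
  then have "x [^] (k mod a) \<otimes> y [^] (0::nat) = x [^] (0::nat) \<otimes> y [^] (0::nat)"
    by (simp add: x_pow_mod)
  then have "k mod a = 0"
    using inj_onD[OF inj_on_normal_form[OF assms], of "(k mod a, 0)" "(0, 0)"] a_pos b_pos by simp
  then show "a dvd k" by auto
next
  assume "a dvd k"
  then show "x [^] k = \<one>" using x_pow_mod[of k] by simp
qed

text \<open>The square of \<open>x^i\<close> is \<open>x^(2i)\<close> and that of
  \<open>x^i y\<close> is \<open>x^(i + i d + c)\<close>; as normal forms are unique, the summands
  count the elements with trivial square.\<close>

lemma (in metacyclic) num_subgroups_2_metacyclic:
  assumes "a = 4" "b = 2" and order: "order G = 8"
  shows "num_subgroups 2 G + 1 = (\<Sum>i<4. of_bool (4 dvd 2 * i) + of_bool (4 dvd i + i * d + c))"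
proof -
  interpret finite_group G using finite_carrier by unfold_locales
  let ?f = "\<lambda>(i :: nat, j :: nat). x [^] i \<otimes> y [^] j"
  have ord: "order G = a * b" using assms by simp
  have sq0: "(x [^] i \<otimes> y [^] (0::nat)) \<otimes> (x [^] i \<otimes> y [^] (0::nat)) = \<one> \<longleftrightarrow> 4 dvd 2 * i" for i :: nat
    using x_pow_eq_one_iff[OF ord, of "i + i"] assms by (simp add: mult_2 nat_pow_mult)
  have "y [^] (2::nat) = x [^] c" using y_pow assms by simp
  then have sq1: "(x [^] i \<otimes> y [^] (1::nat)) \<otimes> (x [^] i \<otimes> y [^] (1::nat)) = \<one> \<longleftrightarrow> 4 dvd i + i * d + c" for i :: nat
    unfolding normal_form_mult using x_pow_eq_one_iff[OF ord] assms
    by (simp add: nat_pow_mult one_add_one del: One_nat_def)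
  have "{g \<in> carrier G. g \<otimes> g = \<one>} = ?f ` {u \<in> {..<a} \<times> {..<b}. ?f u \<otimes> ?f u = \<one>}"
    by (subst carrier_eq) auto
  moreover have "inj_on ?f {u \<in> {..<a} \<times> {..<b}. ?f u \<otimes> ?f u = \<one>}"
    using inj_on_normal_form[OF ord] by (rule inj_on_subset) auto
  ultimately have "num_subgroups 2 G + 1 = card {u \<in> {..<a} \<times> {..<b}. ?f u \<otimes> ?f u = \<one>}"
    unfolding num_subgroups_2 by (simp only: card_image)
  also have "\<dots> = (\<Sum>u\<in>{..<a} \<times> {..<b}. of_bool (?f u \<otimes> ?f u = \<one>))"
    by (simp add: Int_def)
  also have "\<dots> = (\<Sum>i<a. \<Sum>j<b. of_bool (?f (i, j) \<otimes> ?f (i, j) = \<one>))"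
    unfolding sum.cartesian_product by (rule sum.cong) auto
  also have "\<dots> = (\<Sum>i<4. of_bool (4 dvd 2 * i) + of_bool (4 dvd i + i * d + c))"
    using assms sq0 sq1 by (simp add: numeral_2_eq_2)
  finally show ?thesis .
qed

subsection \<open>Groups of exponent \<open>2\<close>\<close>

text \<open>All words are squared, not only the generators: exponent 2, and with it commutativity,
  is then immediate in the presented group.\<close>

definition exponent_two_relations :: "('a word \<times> 'a word) set" where
  "exponent_two_relations = {(w @ w, []) | w. True}"

lemma (in group) comm_group_if_exponent_two:
  assumes sq: "\<And>g. g \<in> carrier G \<Longrightarrow> g \<otimes> g = \<one>"
  shows "comm_group G"
proof (rule group_comm_groupI)
  have inv: "inv g = g" if "g \<in> carrier G" for g using that sq by (intro inv_equality)
  show "x \<otimes> y = y \<otimes> x" if "x \<in> carrier G" "y \<in> carrier G" for x y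
    using that by (metis inv inv_mult_group m_closed)
qed

lemma exponent_two_presented_group:
  assumes "g \<in> carrier (presented_group exponent_two_relations)"
  shows "g \<otimes>\<^bsub>presented_group exponent_two_relations\<^esub> g = \<one>\<^bsub>presented_group exponent_two_relations\<^esub>"
proof -
  let ?R = "exponent_two_relations"
  obtain u where u: "g = word_cong ?R `` {u}"
    using assms by (auto simp: presented_group_def quotient_def)
  have "(u @ u, []) \<in> word_cong ?R" by (rule word_cong.rel) (auto simp: exponent_two_relations_def)
  then have "word_cong ?R `` {u @ u} = word_cong ?R `` {[]}"
    by (rule equiv_class_eq[OF equiv_word_cong])
  then show ?thesis unfolding u presented_group_mult by (simp add: presented_group_def)
qed

text \<open>Every element is the product over a set of generators, since multiplying by a generator
  toggles its membership in the set. This bounds the order by the number of such sets.\<close>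

lemma carrier_exponent_two_presented_group:
  fixes R :: "('a :: finite word \<times> 'a word) set"
  assumes R: "R = exponent_two_relations"
  shows "carrier (presented_group R) \<subseteq> finprod (presented_group R) (gen_class R) ` UNIV"
proof (rule carrier_presented_group_subset)
  let ?P = "presented_group R"
  interpret P: comm_group ?P
    unfolding R using group.comm_group_if_exponent_two[OF group_presented_group exponent_two_presented_group] .
  have cl: "gen_class R x \<in> carrier ?P" for x using gen_class_closed[of R] by auto
  have sq: "g \<otimes>\<^bsub>?P\<^esub> g = \<one>\<^bsub>?P\<^esub>" if "g \<in> carrier ?P" for g
    using that unfolding R by (rule exponent_two_presented_group)
  show "\<one>\<^bsub>?P\<^esub> \<in> finprod ?P (gen_class R) ` UNIV"
    by (rule image_eqI[of _ _ "{}"]) auto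
  fix x b A assume "A \<in> finprod ?P (gen_class R) ` UNIV"
  then obtain X where X: "A = finprod ?P (gen_class R) X" by blast
  have "inv\<^bsub>?P\<^esub> gen_class R x = gen_class R x" by (intro P.inv_equality sq cl)
  then have "word_cong R `` {[(x, b)]} = gen_class R x"
    using inv_gen_class[of R x] by (cases b) (simp_all add: gen_class_def)
  moreover have "gen_class R x \<otimes>\<^bsub>?P\<^esub> A \<in> finprod ?P (gen_class R) ` UNIV"
  proof (cases "x \<in> X")
    case True
    have "finprod ?P (gen_class R) (insert x (X - {x})) =
        gen_class R x \<otimes>\<^bsub>?P\<^esub> finprod ?P (gen_class R) (X - {x})"
      using cl by (intro P.finprod_insert) auto
    then have "gen_class R x \<otimes>\<^bsub>?P\<^esub> A =
        (gen_class R x \<otimes>\<^bsub>?P\<^esub> gen_class R x) \<otimes>\<^bsub>?P\<^esub> finprod ?P (gen_class R) (X - {x})"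
      using True cl by (simp add: X insert_absorb P.m_assoc)
    also have "\<dots> = finprod ?P (gen_class R) (X - {x})"
      using sq[OF cl] cl by simp
    finally show ?thesis by blast
  next
    case False
    have "finprod ?P (gen_class R) (insert x X) = gen_class R x \<otimes>\<^bsub>?P\<^esub> A"
      unfolding X using False cl by (intro P.finprod_insert) auto
    then show ?thesis by (metis rangeI)
  qed
  ultimately show "word_cong R `` {[(x, b)]} \<otimes>\<^bsub>?P\<^esub> A \<in> finprod ?P (gen_class R) ` UNIV" by simp
qed

lemma (in group) presented_group_iso_exponent_two:
  fixes f :: "'i :: finite \<Rightarrow> 'a"
  assumes f: "range f \<subseteq> carrier G" and sq: "\<And>g. g \<in> carrier G \<Longrightarrow> g \<otimes> g = \<one>"
    and gen: "\<And>K. subgroup K G \<Longrightarrow> range f \<subseteq> K \<Longrightarrow> carrier G \<subseteq> K"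
    and order: "order G = 2 ^ CARD('i)"
  shows "presented_group (exponent_two_relations :: ('i word \<times> 'i word) set) \<cong> G"
proof (rule presented_group_iso[OF is_group f])
  show "eval_word G f u = eval_word G f v" if "(u, v) \<in> exponent_two_relations" for u v
    using that f sq by (auto simp: exponent_two_relations_def eval_word_append)
  let ?P = "presented_group (exponent_two_relations :: ('i word \<times> 'i word) set)"
  note sub = carrier_exponent_two_presented_group[OF HOL.refl, where ?'a = 'i]
  show "finite (carrier ?P)" by (rule finite_subset[OF sub]) simp
  have "card (carrier ?P) \<le> card (UNIV :: 'i set set)"
    using sub by (rule surj_card_le[rotated]) simp
  then show "card (carrier ?P) \<le> order G" by (simp add: order card_UNIV_set)
qed (rule gen)

text \<open>Each of \<open>x\<close>, \<open>y\<close>, \<open>w\<close> is chosen outside the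
  subgroup generated by its predecessors; the three-element type \<open>bool option\<close> indexes
  them.\<close>

lemma (in finite_group) presented_group_iso_order_8_exponent_two:
  assumes order: "order G = 8" and sq: "\<And>g. g \<in> carrier G \<Longrightarrow> g \<otimes> g = \<one>"
  shows "presented_group (exponent_two_relations :: (bool option word \<times> bool option word) set) \<cong> G"
proof -
  obtain x where x: "x \<in> carrier G" "x \<noteq> \<one>"
    using ex_notin_if_card_lt[of "{\<one>}"] order by auto
  obtain y where y: "y \<in> carrier G" "y \<notin> {\<one>, x}"
    using ex_notin_if_card_lt[of "{\<one>, x}"] order x by auto
  have xy: "x \<otimes> y \<noteq> \<one>" "x \<otimes> y \<noteq> x" "x \<otimes> y \<noteq> y"
    using x y sq[OF x(1)] by (auto dest: inv_equality) (metis inv_equality inv_comm)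
  obtain w where w: "w \<in> carrier G" "w \<notin> {\<one>, x, y, x \<otimes> y}"
    using ex_notin_if_card_lt[of "{\<one>, x, y, x \<otimes> y}"] order x y xy by auto
  let ?f = "\<lambda>i. case i of None \<Rightarrow> x | Some False \<Rightarrow> y | Some True \<Rightarrow> w"
  show ?thesis
  proof (rule presented_group_iso_exponent_two)
    show "range ?f \<subseteq> carrier G" using x y w by (auto split: option.split bool.split)
    fix K assume K: "subgroup K G" "range ?f \<subseteq> K"
    have "?f None \<in> K" "?f (Some False) \<in> K" "?f (Some True) \<in> K" using K(2) by blast+
    \<comment> \<open>Five elements are more than half of the group, so \<open>K\<close> is
      everything.\<close>
    then have "{\<one>, x, y, x \<otimes> y, w} \<subseteq> K"
      using K(1) by (simp add: subgroup.one_closed subgroup.m_closed)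
    then have "card {\<one>, x, y, x \<otimes> y, w} \<le> card K" by (intro card_mono finite_subgroup K(1))
    moreover have "card {\<one>, x, y, x \<otimes> y, w} = 5" using x y w xy by auto
    ultimately have "2 ^ 2 < card K" by simp
    then show "carrier G \<subseteq> K"
      using order by (intro carrier_subset_if_card_gt[of 2 2 K] K(1)) simp_all
  qed (use sq order in auto)
qed

subsection \<open>Isomorphism from equal numbers of subgroups\<close>

text \<open>The counts separate the five types. Only the cyclic and quaternion cases may share a
  count for order 2, and order 4 tells these apart.\<close>

lemma (in finite_group) order_8_cases:
  assumes order: "order G = 8"
  obtains
    (cyclic) x where "metacyclic G x \<one> 8 1 0 1" "num_subgroups 2 G \<le> 1" "num_subgroups 4 G \<le> 1"
  | (abelian) x y where "metacyclic G x y 4 2 0 1" "num_subgroups 2 G = 3"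
  | (dihedral) x y where "metacyclic G x y 4 2 0 3" "num_subgroups 2 G = 5"
  | (quaternion) x y where "metacyclic G x y 4 2 2 3" "num_subgroups 2 G = 1" "2 \<le> num_subgroups 4 G"
  | (elementary) "\<And>g. g \<in> carrier G \<Longrightarrow> g \<otimes> g = \<one>" "num_subgroups 2 G = 7"
proof -
  have order': "order G = 2 ^ Suc 2" by (simp add: order)
  consider (8) x where "x \<in> carrier G" "ord x = 8"
    | (2) "\<forall>g\<in>carrier G. g \<otimes> g = \<one>"
    | (4) x where "x \<in> carrier G" "x \<otimes> x \<noteq> \<one>" "\<forall>g\<in>carrier G. ord g \<noteq> 8"
    by blast
  then show ?thesis
  proof cases
    case 8
    then show ?thesis
      using cyclic[of x] metacyclic_if_cyclic[of x] num_subgroups_le_1_if_cyclic[of x] order by simp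
  next
    case 2
    then have "{g \<in> carrier G. g \<otimes> g = \<one>} = carrier G" by blast
    then have "num_subgroups 2 G = 7" using num_subgroups_2 order by (simp add: order_def)
    with 2 show ?thesis using elementary by blast
  next
    case 4
    have pow4: "g [^] (4::nat) = \<one>" if "g \<in> carrier G" for g
    proof -
      obtain i where i: "i \<le> Suc 2" "ord g = 2 ^ i"
        using ord_prime_power[OF two_is_prime_nat order' \<open>g \<in> carrier G\<close>] .
      moreover have "i \<noteq> 3" using i 4 that by auto
      ultimately have "i \<le> 2" by simp
      then have "ord g dvd 2 ^ 2" unfolding i(2) by (rule le_imp_power_dvd)
      then show ?thesis using pow_eq_id[OF that] by simp
    qed
    have ord4: "ord g = 4" if "g \<in> carrier G" "g \<otimes> g \<noteq> \<one>" for g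
    proof -
      obtain i where i: "i \<le> Suc 2" "ord g = 2 ^ i"
        using ord_prime_power[OF two_is_prime_nat order' \<open>g \<in> carrier G\<close>] .
      have "\<not> ord g dvd 2"
        using pow_eq_id[OF that(1), of 2] that by (simp add: numeral_2_eq_2)
      then have "\<not> i \<le> 1" using i(2) le_imp_power_dvd[of i 1 "2::nat"] by auto
      moreover have "i \<noteq> 3" using i 4 that by auto
      ultimately have "i = 2" using i by simp
      then show ?thesis using i by simp
    qed
    note x = 4(1)
    have ordx: "ord x = 4" using ord4 4 by simp
    let ?H = "generate G {x}"
    have H: "subgroup ?H G" "card ?H = 4"
      using subgroup_generate[OF x] generate_pow_card[OF x] ordx by auto
    have xpow: "x [^] k = \<one> \<longleftrightarrow> 4 dvd k" for k :: nat using pow_eq_id[OF x] ordx by simp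
    obtain y where y: "y \<in> carrier G" "y \<notin> ?H"
      using ex_notin_if_card_lt[OF finite_subgroup[OF H(1)]] H order by auto
    have index: "order G = 2 * card ?H" using H order by simp
    have yx: "y \<otimes> x \<notin> ?H"
    proof
      assume "y \<otimes> x \<in> ?H"
      then have "y \<otimes> x \<otimes> inv x \<in> ?H" using H(1) mem_generate
        by (simp add: subgroup.m_closed subgroup.m_inv_closed)
      then show False using x y by (simp add: m_assoc)
    qed
    have "inv y \<notin> ?H" using y subgroup.m_inv_closed[OF H(1), of "inv y"] by auto
    \<comment> \<open>A product of two elements outside the index-2 subgroup \<open>?H\<close> lies
      in it; so \<open>y x y^-1\<close> here and \<open>y y\<close> below are powers of
      \<open>x\<close>.\<close>
    then have "y \<otimes> x \<otimes> inv y \<in> ?H"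
      using mult_mem_if_index_2[OF H(1) index _ yx] x y by simp
    then obtain d :: nat where d: "d < 4" "y \<otimes> x \<otimes> inv y = x [^] d"
      unfolding generate_eq_powers[OF x] ordx by auto
    then have rel_d: "y \<otimes> x = x [^] d \<otimes> y"
      using x y by (metis inv_closed inv_solve_right m_closed nat_pow_closed)
    have "y \<otimes> y \<in> ?H" using mult_mem_if_index_2[OF H(1) index] y by blast
    then obtain c :: nat where c: "c < 4" "y \<otimes> y = x [^] c"
      unfolding generate_eq_powers[OF x] ordx by auto
    have metaI: "metacyclic G x v 4 2 c' d'"
      if "v \<in> carrier G" "v \<notin> ?H" "v \<otimes> v = x [^] c'" "v \<otimes> x = x [^] d' \<otimes> v" for v c' d'
    proof -
      have "v [^] (2::nat) = x [^] c'" using that by (simp add: numeral_2_eq_2)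
      then show ?thesis using metacyclicI[OF two_is_prime_nat order' x, of v c' d'] that ordx by simp
    qed
    interpret M: metacyclic G x y 4 2 c d by (rule metaI[OF y c(2) rel_d])
    \<comment> \<open>\<open>x^(2c) = y^4\<close> is trivial, so \<open>c\<close> is even.\<close>
    have "y [^] (4::nat) = (y \<otimes> y) \<otimes> (y \<otimes> y)" using y by (simp add: numeral_eq_Suc m_assoc)
    then have "x [^] (c + c) = y [^] (4::nat)" using x by (simp add: c(2) nat_pow_mult)
    then have "4 dvd c + c" using pow4[OF y(1)] xpow by simp
    then have c': "c = 0 \<or> c = 2" using c(1) by presburger
    \<comment> \<open>For even \<open>d\<close>, \<open>y x^2 = x^(2d) y = y\<close>, although
      \<open>x\<close> has order 4.\<close>
    have "odd d"
    proof
      assume "even d"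
      then have "x [^] (2 * d) = \<one>" by (simp add: xpow)
      then have "y \<otimes> x [^] (2::nat) = y" using M.y_x_pow[of 2] y by simp
      then show False using x y xpow[of 2] by simp
    qed
    then have d': "d = 1 \<or> d = 3" using d(1) by presburger
    have sum4: "sum f {..<4} = f 0 + f 1 + f 2 + f 3" for f :: "nat \<Rightarrow> nat"
      by (simp add: numeral_eq_Suc)
    consider "c = 0" "d = 1" | "c = 2" "d = 1" | "c = 0" "d = 3" | "c = 2" "d = 3"
      using c' d' by blast
    then show ?thesis
    proof cases
      case 1
      then have m: "metacyclic G x y 4 2 0 1" using M.metacyclic_axioms by simp
      then show ?thesis
        using abelian metacyclic.num_subgroups_2_metacyclic[OF m] order by (simp add: sum4 flip: numeral_2_eq_2)
    next
      case 2
      then have comm: "y \<otimes> x = x \<otimes> y" and yy: "y \<otimes> y = x [^] (2::nat)"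
        using rel_d c x by simp_all
      \<comment> \<open>Replacing \<open>y\<close> by \<open>x \<otimes> y\<close>, whose square is
        \<open>x^4 = \<one>\<close>, turns \<open>c = 2\<close> into \<open>c = 0\<close>.\<close>
      have "(x \<otimes> y) \<otimes> (x \<otimes> y) = x \<otimes> (y \<otimes> x) \<otimes> y" using x y by (simp add: m_assoc)
      also have "\<dots> = (x \<otimes> x) \<otimes> (y \<otimes> y)" using x y by (simp add: comm m_assoc)
      also have "\<dots> = x [^] (4::nat)" using x by (simp add: yy numeral_eq_Suc m_assoc)
      finally have sq: "(x \<otimes> y) \<otimes> (x \<otimes> y) = x [^] (0::nat)" using pow4[OF x] by simp
      have "x \<otimes> y \<notin> ?H" using yx comm by simp
      moreover have "(x \<otimes> y) \<otimes> x = x [^] (1::nat) \<otimes> (x \<otimes> y)" using x y by (simp add: comm m_assoc)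
      ultimately have m: "metacyclic G x (x \<otimes> y) 4 2 0 1" using x y sq by (intro metaI) auto
      then show ?thesis
        using abelian metacyclic.num_subgroups_2_metacyclic[OF m] order by (simp add: sum4 flip: numeral_2_eq_2)
    next
      case 3
      then have m: "metacyclic G x y 4 2 0 3" using M.metacyclic_axioms by simp
      then show ?thesis
        using dihedral metacyclic.num_subgroups_2_metacyclic[OF m] order by (simp add: sum4 flip: numeral_2_eq_2)
    next
      case 4
      then have m: "metacyclic G x y 4 2 2 3" using M.metacyclic_axioms by simp
      \<comment> \<open>As \<open>y\<close> has order 4 and lies outside \<open>?H\<close>, it
        generates a second subgroup of order 4.\<close>
      have "ord y = 4" using c(2) 4 xpow[of 2] y by (intro ord4) auto
      then have "2 \<le> num_subgroups 4 G"
        using H y subgroup_generate generate_pow_card mem_generate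
        by (intro two_le_num_subgroups[OF H(1), of "generate G {y}"]) auto
      with m show ?thesis
        using quaternion metacyclic.num_subgroups_2_metacyclic[OF m] order by (simp add: sum4 flip: numeral_2_eq_2)
    qed
  qed
qed

lemma iso_if_presented_group_iso:
  assumes "presented_group R \<cong> G" "presented_group R \<cong> G'"
  shows "G' \<cong> G"
  using iso_trans[OF group.iso_sym[OF group_presented_group assms(2)] assms(1)] .

lemma order_8_iso_if_num_subgroups_eq:
  assumes "finite_group G" "finite_group G'" and order: "order G = 8" "order G' = 8"
    and num: "num_subgroups 2 G' = num_subgroups 2 G" "num_subgroups 4 G' = num_subgroups 4 G"
  shows "G' \<cong> G"
proof -
  interpret G: finite_group G by fact
  interpret G': finite_group G' by fact
  note iso = metacyclic_iso[of G _ _ _ _ _ _ G']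
  show ?thesis
    by (cases rule: G.order_8_cases[OF order(1)]; cases rule: G'.order_8_cases[OF order(2)])
      (use num order iso iso_if_presented_group_iso[OF
        G.presented_group_iso_order_8_exponent_two G'.presented_group_iso_order_8_exponent_two]
        in auto)
qed

lemma (in finite_group) order_prime_square_cases:
  assumes p: "prime p" and order: "order G = p\<^sup>2"
  obtains
    (cyclic) x where "metacyclic G x \<one> (p\<^sup>2) 1 0 1" "num_subgroups p G \<le> 1"
  | (elementary) x y where "metacyclic G x y p p 0 1" "2 \<le> num_subgroups p G"
proof (cases "\<exists>x\<in>carrier G. ord x = order G")
  case True
  then obtain x where x: "x \<in> carrier G" "ord x = order G" by blast
  show ?thesis
    using cyclic metacyclic_if_cyclic[OF x] num_subgroups_le_1_if_cyclic[OF x] order by simp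
next
  case False
  then show ?thesis using order_prime_square_noncyclic[OF p order] elementary by blast
qed

lemma order_prime_square_iso_if_num_subgroups_eq:
  assumes "finite_group G" "finite_group G'" and p: "prime p"
    and order: "order G = p\<^sup>2" "order G' = p\<^sup>2"
    and num: "num_subgroups p G' = num_subgroups p G"
  shows "G' \<cong> G"
proof -
  interpret G: finite_group G by fact
  interpret G': finite_group G' by fact
  show ?thesis
    by (cases rule: G.order_prime_square_cases[OF p order(1)];
        cases rule: G'.order_prime_square_cases[OF p order(2)])
      (use num order in \<open>auto simp: power2_eq_square intro: metacyclic_iso\<close>)
qed

lemma (in finite_group) cyclic_if_order_le_prime:
  assumes p: "prime p" and k: "k \<le> 1" and order: "order G = p ^ k"
  obtains x where "metacyclic G x \<one> (p ^ k) 1 0 1"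
proof -
  obtain x where x: "x \<in> carrier G" "k = 1 \<longrightarrow> x \<noteq> \<one>"
  proof (cases "k = 1")
    case True
    then show ?thesis
      using that ex_notin_if_card_lt[of "{\<one>}"] order prime_gt_1_nat[OF p] by auto
  qed (use that[of \<one>] in simp)
  obtain i where i: "i \<le> k" "ord x = p ^ i" using ord_prime_power[OF p order x(1)] .
  have "k = 1 \<longrightarrow> i \<noteq> 0" using i x ord_eq_1[OF x(1)] by (intro impI notI) simp
  then have "i = k" using i k by auto
  then show ?thesis using that metacyclic_if_cyclic[OF x(1)] i order by simp
qed

lemma iso_if_order_le_prime:
  assumes "finite_group G" "finite_group G'" and p: "prime p" and k: "k \<le> 1"
    and order: "order G = p ^ k" "order G' = p ^ k"
  shows "G' \<cong> G"
proof -
  interpret G: finite_group G by fact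
  interpret G': finite_group G' by fact
  show ?thesis
    using G.cyclic_if_order_le_prime[OF p k order(1)] G'.cyclic_if_order_le_prime[OF p k order(2)]
      metacyclic_iso order by (metis mult.right_neutral)
qed

section \<open>Recovering the group from its zeta function\<close>

lemma iso_if_group_zeta_eq:
  assumes p: "prime p" and k: "k \<le> (if p = 2 then 3 else 2)"
    and G: "group G" "finite (carrier G)" "order G = p ^ k"
    and G': "group G'" "finite (carrier G')" and zeta: "group_zeta G' = group_zeta G"
  shows "G' \<cong> G"
proof -
  have fg: "finite_group G" "finite_group G'"
    using G G' by (auto simp: finite_group_def finite_group_axioms_def)
  have order': "order G' = p ^ k"
    using order_eq_if_group_zeta_eq[OF G(1,2) G' zeta] G by simp
  note num = num_subgroups_eq_if_group_zeta_eq[OF G(1,2) G' zeta]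
  consider "k \<le> 1" | "k = 2" | "p = 2" "k = 3" using k by (force split: if_splits)
  then show ?thesis
  proof cases
    case 1
    then show ?thesis using iso_if_order_le_prime[OF fg p] G order' by blast
  next
    case 2
    then show ?thesis using order_prime_square_iso_if_num_subgroups_eq[OF fg p] G order' num by blast
  next
    case 3
    then show ?thesis using order_8_iso_if_num_subgroups_eq[OF fg] G order' num by simp
  qed
qed

theorem proposition1p3:
  shows
    "(\<forall>p m n :: nat. prime p \<and> 1 \<le> n \<and> n < m \<and> (p = 2 \<longrightarrow> 3 \<le> m) \<longrightarrow>
        group (Gp p m n) \<and> finite (carrier (Gp p m n)) \<and>
        \<not> comm_group (Gp p m n) \<and> order (Gp p m n) = p ^ (m + n) \<and>
        group_zeta (Gp p m n) = group_zeta (integer_mod_group (p ^ m) \<times>\<times> integer_mod_group (p ^ n)) \<and>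
        (\<forall>s :: complex.
           group_zeta (Gp p m n) s = of_nat (order (Gp p m n)) powr (- s) * group_zeta (Gp p m n) (- s)))
     \<and>
     (\<forall>(G :: ('a, 'c) monoid_scheme) (G' :: ('b, 'd) monoid_scheme) (p :: nat) (k :: nat).
        prime p \<and> k \<le> (if p = 2 then 3 else 2) \<and>
        group G \<and> finite (carrier G) \<and> order G = p ^ k \<and>
        group G' \<and> finite (carrier G') \<and> group_zeta G' = group_zeta G
        \<longrightarrow> G' \<cong> G)"
proof (rule conjI)
  show "\<forall>p m n :: nat. prime p \<and> 1 \<le> n \<and> n < m \<and> (p = 2 \<longrightarrow> 3 \<le> m) \<longrightarrow>
      group (Gp p m n) \<and> finite (carrier (Gp p m n)) \<and>
      \<not> comm_group (Gp p m n) \<and> order (Gp p m n) = p ^ (m + n) \<and>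
      group_zeta (Gp p m n) = group_zeta (integer_mod_group (p ^ m) \<times>\<times> integer_mod_group (p ^ n)) \<and>
      (\<forall>s. group_zeta (Gp p m n) s = of_nat (order (Gp p m n)) powr (- s) * group_zeta (Gp p m n) (- s))"
  proof (intro allI impI)
    fix p m n :: nat
    assume "prime p \<and> 1 \<le> n \<and> n < m \<and> (p = 2 \<longrightarrow> 3 \<le> m)"
    then interpret twisted_product p m n by unfold_locales auto
    show "group (Gp p m n) \<and> finite (carrier (Gp p m n)) \<and>
      \<not> comm_group (Gp p m n) \<and> order (Gp p m n) = p ^ (m + n) \<and>
      group_zeta (Gp p m n) = group_zeta (integer_mod_group (p ^ m) \<times>\<times> integer_mod_group (p ^ n)) \<and>
      (\<forall>s. group_zeta (Gp p m n) s = of_nat (order (Gp p m n)) powr (- s) * group_zeta (Gp p m n) (- s))"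
      by (intro conjI allI group_Gp finite_Gp not_comm_Gp order_Gp group_zeta_Gp group_zeta_Gp_symmetry)
  qed
qed (use iso_if_group_zeta_eq in blast)
end
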